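(* On the noncommutative 2-torus $\mathcal A=\mathbb T^2_\theta$ ($\theta$ irrational), regarded as a quantum principal $U(1)$-bundle over $\mathcal B=C^\infty(S^1)$ via $\delta_2$, the only strong connection compatible with the flat (fully $U(1)^2$-equivariant) Dirac operator $D=\sigma^1\delta_1+\sigma^2\delta_2$ is $\omega=\sigma^2$.
   Context: $\mathcal A=\mathbb T^2_\theta$ is the smooth algebra of the noncommutative 2-torus with unitary generators $U,V$, $UV=e^{2\pi i\theta}VU$. The derivations satisfy $\delta_1(U)=U$, $\delta_1(V)=0$, $\delta_2(U)=0$, $\delta_2(V)=V$. The $U(1)$-action is generated by $\delta=\delta_2$; $\mathcal A^{(k)}=\{a:\delta_2(a)=ka\}$ and $\mathcal B=\mathcal A^{(0)}$ is the (commutative) smooth algebra generated by $U$. $\mathcal H=\mathcal H_\tau\otimes\mathbb C^2$, $\mathcal H_\tau$ the GNS space of the unique tracial state; $\mathcal A$ acts on the first factor, and $\delta_1,\delta_2$ also denote the selfadjoint operators on $\mathcal H$ (integer spectrum, killing the cyclic vector) implementing the derivations. $\mathcal H_k$ is the $k$-eigenspace of $\delta_2$. $\sigma^i$ are the Pauli matrices acting on $\mathbb C^2$; $\gamma=\mathrm{id}\otimes\sigma^3$; $J=J_0\otimes(i\sigma^2\circ c.c.)$ with $J_0$ the Tomita–Takesaki antiunitary involution on $\mathcal H_\tau$ and $c.c.$ complex conjugation; $\Gamma=\mathrm{id}\otimes\sigma^2$. The horizontal Dirac operator is $D_h=\frac12\Gamma[\Gamma,D]=\sigma^1\delta_1$.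 $\Omega^1_D(\mathcal A)$ (resp. $\Omega^1_D(\mathcal B)$) is the span of $a'[D,a]$ with $a,a'\in\mathcal A$ (resp. $\mathcal B$). A strong connection is $\omega\in\Omega^1_D(\mathcal A)$ with $[\delta_2,\omega]=0$; $\sum_ip_i\delta_2(q_i)=1$ whenever $\omega=\sum_ip_i[D,q_i]$; and $\nabla_\omega(a):=[D,a]-\delta_2(a)\omega\in\Omega^1_D(\mathcal B)\mathcal A$ for all $a\in\mathcal A$. Right actions: $ha:=Ja^*J^{-1}h$; for $b,b'\in\mathcal B$, $h(b'[D,b]):=[D,Jb^*J^{-1}](hb')$ (so $h\eta=-J\eta^*J^{-1}h$ for $\eta\in\Omega^1_D(\mathcal B)$), and $h(\eta a)=(h\eta)a$. The twisted Dirac operator $D_\omega$ is determined on the span of the vectors $ha$ ($h\in\mathcal H_0$ in the domain of $D_h$, $a\in\mathcal A^{(k)}$, $k\in\mathbb Z$) by $D_\omega(ha)=(D_hh)a+h\nabla_\omega(a)$. A strong connection $\omega$ is compatible with $D$ if $D_\omega$ and $D_h$ coincide on a dense subset of $\mathcal H$. *)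

theory Defs
  imports "HOL-Analysis.Analysis"
begin

typedef 'i ell2 = "{f :: 'i \<Rightarrow> complex. (\<lambda>i. (cmod (f i))\<^sup>2) summable_on UNIV}"
  morphisms coord Abs_ell2
  by (rule exI[of _ "\<lambda>_. 0"]) simp

setup_lifting type_definition_ell2

lemma coord_summable: "(\<lambda>i. (cmod (coord f i))\<^sup>2) summable_on UNIV"
  using coord[of f] by simp

lemma ell2_eqI: "(\<And>i. coord f i = coord g i) \<Longrightarrow> f = g"
  by (metis coord_inject ext)

lemma square_summable_add:
  assumes "(\<lambda>i. (cmod (f i))\<^sup>2) summable_on UNIV" "(\<lambda>i. (cmod (g i))\<^sup>2) summable_on UNIV"
  shows "(\<lambda>i. (cmod (f i + g i))\<^sup>2) summable_on UNIV"
proof (rule summable_on_comparison_test)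
  show "(\<lambda>i. 2 * (cmod (f i))\<^sup>2 + 2 * (cmod (g i))\<^sup>2) summable_on UNIV"
    using assms by (intro summable_on_add summable_on_cmult_right)
  fix i
  have "(cmod (f i + g i))\<^sup>2 \<le> (cmod (f i) + cmod (g i))\<^sup>2"
    by (simp add: norm_triangle_ineq power_mono)
  also have "\<dots> \<le> 2 * (cmod (f i))\<^sup>2 + 2 * (cmod (g i))\<^sup>2"
    using sum_squares_bound[of "cmod (f i)" "cmod (g i)"] by (simp add: power2_sum)
  finally show "(cmod (f i + g i))\<^sup>2 \<le> 2 * (cmod (f i))\<^sup>2 + 2 * (cmod (g i))\<^sup>2" .
qed auto

lemma square_summable_scale:
  assumes "(\<lambda>i. (cmod (f i))\<^sup>2) summable_on UNIV"
  shows "(\<lambda>i. (cmod (c * f i))\<^sup>2) summable_on UNIV"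
  using assms by (simp add: norm_mult power_mult_distrib summable_on_cmult_right)

lift_definition scaleC :: "complex \<Rightarrow> 'i ell2 \<Rightarrow> 'i ell2"  (infixr "*\<^sub>C" 75)
  is "\<lambda>c f i. c * f i"
  by (simp add: square_summable_scale)

definition cinner :: "'i ell2 \<Rightarrow> 'i ell2 \<Rightarrow> complex"
  where "cinner f g = (\<Sum>\<^sub>\<infinity>i. cnj (coord f i) * coord g i)"

instantiation ell2 :: (type) real_vector
begin

lift_definition zero_ell2 :: "'a ell2" is "\<lambda>_. 0" by simp
lift_definition plus_ell2 :: "'a ell2 \<Rightarrow> 'a ell2 \<Rightarrow> 'a ell2" is "\<lambda>f g i. f i + g i"
  by (simp add: square_summable_add)
lift_definition uminus_ell2 :: "'a ell2 \<Rightarrow> 'a ell2" is "\<lambda>f i. - f i" by simp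
lift_definition minus_ell2 :: "'a ell2 \<Rightarrow> 'a ell2 \<Rightarrow> 'a ell2" is "\<lambda>f g i. f i - g i"
  subgoal for f g using square_summable_add[of f "\<lambda>i. - g i"] by simp
  done
lift_definition scaleR_ell2 :: "real \<Rightarrow> 'a ell2 \<Rightarrow> 'a ell2" is "\<lambda>r f i. complex_of_real r * f i"
  by (simp add: square_summable_scale)

instance
  by standard (transfer; auto simp: algebra_simps)+

end

lemma coord_simps [simp]:
  "coord 0 i = 0" "coord (f + g) i = coord f i + coord g i" "coord (- f) i = - coord f i"
  "coord (f - g) i = coord f i - coord g i" "coord (c *\<^sub>C f) i = c * coord f i"
  "coord (r *\<^sub>R f) i = of_real r * coord f i"
  by (transfer; simp)+

lemma scaleR_ell2: "r *\<^sub>R f = complex_of_real r *\<^sub>C f"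
  by (rule ell2_eqI) simp

lemma cinner_summable: "(\<lambda>i. norm (cnj (coord f i) * coord g i)) summable_on UNIV"
proof (rule summable_on_comparison_test)
  show "(\<lambda>i. (cmod (coord f i))\<^sup>2 + (cmod (coord g i))\<^sup>2) summable_on UNIV"
    by (intro summable_on_add coord_summable)
  fix i
  show "norm (cnj (coord f i) * coord g i) \<le> (cmod (coord f i))\<^sup>2 + (cmod (coord g i))\<^sup>2"
    using sum_squares_bound[of "cmod (coord f i)" "cmod (coord g i)"]
      mult_nonneg_nonneg[OF norm_ge_zero norm_ge_zero, of "coord f i" "coord g i"]
    unfolding norm_mult complex_mod_cnj by linarith
qed auto

lemma cinner_summable': "(\<lambda>i. cnj (coord f i) * coord g i) summable_on UNIV"
  by (rule abs_summable_summable[OF cinner_summable])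

lemma cinner_add_left: "cinner (f + g) h = cinner f h + cinner g h"
  unfolding cinner_def coord_simps complex_cnj_add distrib_right
  by (rule infsum_add[OF cinner_summable' cinner_summable'])

lemma cinner_scaleC_left: "cinner (c *\<^sub>C f) g = cnj c * cinner f g"
  unfolding cinner_def coord_simps complex_cnj_mult mult.assoc
  by (rule infsum_cmult_right'[symmetric, symmetric])

lemma cinner_scaleC_right: "cinner f (c *\<^sub>C g) = c * cinner f g"
  unfolding cinner_def coord_simps mult.left_commute[of _ c]
  by (rule infsum_cmult_right'[symmetric, symmetric])

lemma cinner_commute: "cinner f g = cnj (cinner g f)"
  unfolding cinner_def infsum_cnj[symmetric] by (simp add: mult.commute)

lemma cinner_self: "cinner f f = of_real (\<Sum>\<^sub>\<infinity>i. (cmod (coord f i))\<^sup>2)"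
proof -
  have "((\<lambda>i. complex_of_real ((cmod (coord f i))\<^sup>2)) has_sum of_real (\<Sum>\<^sub>\<infinity>i. (cmod (coord f i))\<^sup>2)) UNIV"
    using coord_summable[of f] has_sum_of_real by (metis has_sum_infsum)
  then have "((\<lambda>i. cnj (coord f i) * coord f i) has_sum of_real (\<Sum>\<^sub>\<infinity>i. (cmod (coord f i))\<^sup>2)) UNIV"
    by (simp add: complex_norm_square mult.commute del: of_real_power)
  then show ?thesis
    unfolding cinner_def by (rule infsumI)
qed

(* The norm is the Hilbert space norm. The library notion of inner product is real valued, so
   inner is the real part of the complex inner product cinner. This does not affect adjoints: for
   a complex-linear T, the adjoint with respect to inner and with respect to cinner agree. *)
instantiation ell2 :: (type) real_inner
begin

definition inner_ell2 :: "'a ell2 \<Rightarrow> 'a ell2 \<Rightarrow> real" where "inner_ell2 f g = Re (cinner f g)"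
definition norm_ell2 :: "'a ell2 \<Rightarrow> real" where "norm_ell2 f = sqrt (inner f f)"
definition dist_ell2 :: "'a ell2 \<Rightarrow> 'a ell2 \<Rightarrow> real" where "dist_ell2 f g = norm (f - g)"
definition sgn_ell2 :: "'a ell2 \<Rightarrow> 'a ell2" where "sgn_ell2 f = f /\<^sub>R norm f"
definition uniformity_ell2 :: "('a ell2 \<times> 'a ell2) filter"
  where "uniformity_ell2 = (INF e\<in>{0 <..}. principal {(x, y). dist x y < e})"
definition open_ell2 :: "'a ell2 set \<Rightarrow> bool"
  where "open_ell2 U = (\<forall>x\<in>U. eventually (\<lambda>(x', y). x' = x \<longrightarrow> y \<in> U) uniformity)"

instance
proof
  fix x y z :: "'a ell2" and r :: real
  show "inner x y = inner y x"
    unfolding inner_ell2_def by (subst cinner_commute) simp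
  show "inner (x + y) z = inner x z + inner y z"
    by (simp add: inner_ell2_def cinner_add_left)
  show "inner (scaleR r x) y = r * inner x y"
    by (simp add: inner_ell2_def scaleR_ell2 cinner_scaleC_left)
  show "0 \<le> inner x x"
    by (simp add: inner_ell2_def cinner_self infsum_nonneg)
  show "inner x x = 0 \<longleftrightarrow> x = 0"
  proof
    assume "inner x x = 0"
    then have "(\<Sum>\<^sub>\<infinity>i. (cmod (coord x i))\<^sup>2) = 0"
      by (simp add: inner_ell2_def cinner_self)
    then have "(cmod (coord x i))\<^sup>2 = 0" for i
      using nonneg_infsum_le_0D[of "\<lambda>i. (cmod (coord x i))\<^sup>2" UNIV i] coord_summable[of x] by simp
    then show "x = 0" by (intro ell2_eqI) simp
  qed (simp add: inner_ell2_def cinner_def)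
qed (simp_all add: norm_ell2_def dist_ell2_def sgn_ell2_def uniformity_ell2_def open_ell2_def)

end

lemma norm_ell2_sq: "(norm f)\<^sup>2 = (\<Sum>\<^sub>\<infinity>i. (cmod (coord f i))\<^sup>2)"
  by (simp add: power2_norm_eq_inner inner_ell2_def cinner_self)

lemma sum_coord_le: "finite F \<Longrightarrow> (\<Sum>i\<in>F. (cmod (coord f i))\<^sup>2) \<le> (norm f)\<^sup>2"
  unfolding norm_ell2_sq by (rule finite_sum_le_infsum[OF coord_summable]) auto

lemma coord_le_norm: "cmod (coord f i) \<le> norm f"
  by (rule power2_le_imp_le) (use sum_coord_le[of "{i}" f] in simp_all)

instance ell2 :: (type) complete_space
proof
  fix X :: "nat \<Rightarrow> 'a ell2"
  assume X: "Cauchy X"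
  have "Cauchy (\<lambda>n. coord (X n) i)" for i
    unfolding Cauchy_iff
  proof (intro allI impI)
    fix e :: real assume "0 < e"
    then obtain M where "\<forall>m\<ge>M. \<forall>n\<ge>M. norm (X m - X n) < e"
      using X by (auto simp: Cauchy_iff)
    then show "\<exists>M. \<forall>m\<ge>M. \<forall>n\<ge>M. norm (coord (X m) i - coord (X n) i) < e"
      by (metis coord_le_norm coord_simps(4) order_le_less_trans)
  qed
  then have "\<exists>l. (\<lambda>n. coord (X n) i) \<longlonglongrightarrow> l" for i
    by (simp add: Cauchy_convergent_iff convergent_def)
  then obtain L where L: "\<And>i. (\<lambda>n. coord (X n) i) \<longlonglongrightarrow> L i" by metis
  have bound: "(\<Sum>i\<in>F. (cmod (coord (X m) i - L i))\<^sup>2) \<le> e\<^sup>2"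
    if "finite F" "m \<ge> M" and M: "\<forall>m\<ge>M. \<forall>n\<ge>M. norm (X m - X n) < e" for F m M e
  proof (rule LIMSEQ_le_const2)
    show "(\<lambda>n. \<Sum>i\<in>F. (cmod (coord (X m) i - coord (X n) i))\<^sup>2)
      \<longlonglongrightarrow> (\<Sum>i\<in>F. (cmod (coord (X m) i - L i))\<^sup>2)"
      by (intro tendsto_sum tendsto_power tendsto_norm tendsto_diff tendsto_const L)
    show "\<exists>N. \<forall>n\<ge>N. (\<Sum>i\<in>F. (cmod (coord (X m) i - coord (X n) i))\<^sup>2) \<le> e\<^sup>2"
    proof (intro exI[of _ M] allI impI)
      fix n assume "n \<ge> M"
      then have "norm (X m - X n) \<le> e" using that by (simp add: less_imp_le)
      then have "(norm (X m - X n))\<^sup>2 \<le> e\<^sup>2" by (simp add: power_mono)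
      then show "(\<Sum>i\<in>F. (cmod (coord (X m) i - coord (X n) i))\<^sup>2) \<le> e\<^sup>2"
        using sum_coord_le[OF \<open>finite F\<close>, of "X m - X n"] by simp
    qed
  qed
  have summ: "(\<lambda>i. (cmod (coord (X m) i - L i))\<^sup>2) summable_on UNIV"
    if "m \<ge> M" "\<forall>m\<ge>M. \<forall>n\<ge>M. norm (X m - X n) < e" for m M e
    by (rule nonneg_bounded_partial_sums_imp_summable_on[where C = "e\<^sup>2"])
      (use bound[OF _ that] in \<open>auto simp: eventually_finite_subsets_at_top\<close>)
  obtain M1 where M1: "\<forall>m\<ge>M1. \<forall>n\<ge>M1. norm (X m - X n) < 1"
    using X unfolding Cauchy_iff by (meson zero_less_one)
  have "(\<lambda>i. (cmod (coord (X M1) i + - (coord (X M1) i - L i)))\<^sup>2) summable_on UNIV"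
    by (rule square_summable_add[OF coord_summable]) (use summ[OF order_refl M1] in \<open>simp add: norm_minus_commute\<close>)
  then have Ls: "L \<in> {f. (\<lambda>i. (cmod (f i))\<^sup>2) summable_on UNIV}" by simp
  define l where "l = Abs_ell2 L"
  have cl: "coord l = L" unfolding l_def by (rule Abs_ell2_inverse[OF Ls])
  have "X \<longlonglongrightarrow> l"
  proof (rule LIMSEQ_I)
    fix e :: real assume "0 < e"
    then obtain M where M: "\<forall>m\<ge>M. \<forall>n\<ge>M. norm (X m - X n) < e / 2"
      using X unfolding Cauchy_iff by (meson half_gt_zero)
    have "norm (X m - l) < e" if "m \<ge> M" for m
    proof -
      have "(norm (X m - l))\<^sup>2 \<le> (e / 2)\<^sup>2"
        unfolding norm_ell2_sq coord_simps cl
        by (rule infsum_le_finite_sums[OF summ[OF that M]]) (use bound[OF _ that M] in auto)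
      then have "norm (X m - l) \<le> e / 2"
        by (rule power2_le_imp_le) (use \<open>0 < e\<close> in simp)
      then show ?thesis using \<open>0 < e\<close> by simp
    qed
    then show "\<exists>no. \<forall>n\<ge>no. norm (X n - l) < e" by blast
  qed
  then show "convergent X" by (auto simp: convergent_def)
qed

instance ell2 :: (type) banach ..

type_synonym tau_space = "(int \<times> int) ell2"

lift_definition ket :: "'i \<Rightarrow> 'i ell2" is "\<lambda>i j. if j = i then 1 else 0"
  by (rule finite_nonzero_values_imp_summable_on) simp

lemma coord_ket: "coord (ket i) j = (if j = i then 1 else 0)"
  by transfer simp

abbreviation vac :: tau_space where "vac \<equiv> ket (0, 0)"

lemma shift_summable:
  fixes f :: "int \<times> int \<Rightarrow> complex"
  assumes "(\<lambda>i. (cmod (f i))\<^sup>2) summable_on UNIV"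
    and "\<And>i. cmod (c i) = 1"
  shows "(\<lambda>i. (cmod ((case i of (m, n) \<Rightarrow> c (m, n) * f (m - k, n - l))))\<^sup>2) summable_on UNIV"
proof -
  have "bij_betw (\<lambda>(m, n). (m - k, n - l)) (UNIV :: (int \<times> int) set) UNIV"
    by (rule bij_betw_byWitness[where f' = "\<lambda>(m, n). (m + k, n + l)"]) auto
  from summable_on_reindex_bij_betw[OF this, of "\<lambda>i. (cmod (f i))\<^sup>2"]
  show ?thesis using assms by (simp add: case_prod_unfold norm_mult)
qed

(* The GNS space of the trace is realised as l^2(Z x Z), with U^m V^n vac as orthonormal basis:
   U e(m,n) = e(m+1,n) and V e(m,n) = exp(-2 pi i theta m) e(m,n+1). The lemmas vac_cyclic,
   vac_tracial and J0_vac below certify the realisation. *)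
lift_definition genU :: "tau_space \<Rightarrow> tau_space" is "\<lambda>f (m, n). f (m - 1, n)"
  subgoal for f using shift_summable[of f "\<lambda>_. 1" 1 0] by simp
  done

lift_definition genV :: "real \<Rightarrow> tau_space \<Rightarrow> tau_space"
  is "\<lambda>\<theta> f (m, n). cis (- 2 * pi * \<theta> * of_int m) * f (m, n - 1)"
  subgoal for \<theta> f using shift_summable[of f "\<lambda>(m, n). cis (- 2 * pi * \<theta> * of_int m)" 0 1] by (simp add: case_prod_unfold)
  done

definition zpow :: "('a \<Rightarrow> 'a) \<Rightarrow> int \<Rightarrow> 'a \<Rightarrow> 'a"
  where "zpow T k = (if 0 \<le> k then T ^^ nat k else inv T ^^ nat (- k))"

definition rapid :: "(int \<times> int \<Rightarrow> complex) \<Rightarrow> bool"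
  where "rapid a \<longleftrightarrow> (\<forall>k::nat. \<exists>C. \<forall>m n. (1 + \<bar>real_of_int m\<bar> + \<bar>real_of_int n\<bar>) ^ k * cmod (a (m, n)) \<le> C)"

(* The algebra acts faithfully and is identified with its image: the operators
   sum a(m,n) U^m V^n with rapidly decreasing coefficients. *)
definition smooth_torus :: "real \<Rightarrow> (tau_space \<Rightarrow> tau_space) set"
  where "smooth_torus \<theta> = {T. \<exists>a. rapid a \<and>
    (\<forall>f. ((\<lambda>(m, n). a (m, n) *\<^sub>C zpow genU m (zpow (genV \<theta>) n f)) has_sum T f) UNIV)}"

(* Tomita-Takesaki involution of (smooth_torus, vac), i.e. T vac |-> T* vac (lemma J0_vac); the
   phase comes from (U^m V^n)* = exp(-2 pi i theta m n) U^(-m) V^(-n). *)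
lift_definition J0 :: "real \<Rightarrow> tau_space \<Rightarrow> tau_space"
  is "\<lambda>\<theta> f (m, n). cis (- 2 * pi * \<theta> * of_int (m * n)) * cnj (f (- m, - n))"
proof -
  fix \<theta> and f :: "int \<times> int \<Rightarrow> complex"
  assume "(\<lambda>i. (cmod (f i))\<^sup>2) summable_on UNIV"
  moreover have "bij_betw (\<lambda>(m, n). (- m, - n)) (UNIV :: (int \<times> int) set) UNIV"
    by (rule bij_betw_byWitness[where f' = "\<lambda>(m, n). (- m, - n)"]) auto
  ultimately show "(\<lambda>i. (cmod (case i of (m, n) \<Rightarrow> cis (- 2 * pi * \<theta> * of_int (m * n)) * cnj (f (- m, - n))))\<^sup>2) summable_on UNIV"
    using summable_on_reindex_bij_betw[of "\<lambda>(m, n). (- m, - n)" UNIV UNIV "\<lambda>i. (cmod (f i))\<^sup>2"]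
    by (simp add: case_prod_unfold norm_mult)
qed

lift_definition weyl :: "real \<Rightarrow> int \<Rightarrow> int \<Rightarrow> tau_space \<Rightarrow> tau_space"
  is "\<lambda>\<theta> k l f (m, n). cis (- 2 * pi * \<theta> * of_int (l * (m - k))) * f (m - k, n - l)"
  subgoal for \<theta> k l f using shift_summable[of f "\<lambda>(m, n). cis (- 2 * pi * \<theta> * of_int (l * (m - k)))" k l] by (simp add: case_prod_unfold)
  done

lemma coord_genU: "coord (genU f) (m, n) = coord f (m - 1, n)"
  by transfer simp
lemma coord_genV: "coord (genV \<theta> f) (m, n) = cis (- 2 * pi * \<theta> * of_int m) * coord f (m, n - 1)"
  by transfer simp
lemma coord_weyl:
  "coord (weyl \<theta> k l f) (m, n) = cis (- 2 * pi * \<theta> * of_int (l * (m - k))) * coord f (m - k, n - l)"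
  by transfer simp
lemma coord_J0: "coord (J0 \<theta> f) (m, n) = cis (- 2 * pi * \<theta> * of_int (m * n)) * cnj (coord f (- m, - n))"
  by transfer simp

lemma ell2_eqI2: "(\<And>m n. coord f (m, n) = coord g (m, n)) \<Longrightarrow> f = g"
  by (rule ell2_eqI) auto

lemma UV_commutation: "genU (genV \<theta> f) = cis (2 * pi * \<theta>) *\<^sub>C genV \<theta> (genU f)"
  by (rule ell2_eqI2)
    (simp add: coord_genU coord_genV mult.assoc[symmetric] cis_mult, simp add: algebra_simps)

lemma weyl_0: "weyl \<theta> 0 0 f = f"
  by (rule ell2_eqI2) (simp add: coord_weyl)
lemma weyl_U: "weyl \<theta> k 0 (weyl \<theta> k' l f) = weyl \<theta> (k + k') l f"
  by (rule ell2_eqI2) (simp add: coord_weyl algebra_simps)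
lemma weyl_V: "weyl \<theta> 0 l (weyl \<theta> 0 l' f) = weyl \<theta> 0 (l + l') f"
  by (rule ell2_eqI2) (simp add: coord_weyl mult.assoc[symmetric] cis_mult, simp add: algebra_simps)
lemma genU_weyl: "genU = weyl \<theta> 1 0"
  by (rule ext, rule ell2_eqI2) (simp add: coord_weyl coord_genU)
lemma genV_weyl: "genV \<theta> = weyl \<theta> 0 1"
  by (rule ext, rule ell2_eqI2) (simp add: coord_weyl coord_genV)

lemma zpow_eqI:
  assumes W: "\<And>k l f. W k (W l f) = W (k + l) f" "\<And>f. W 0 f = f" and T: "T = W (1::int)"
  shows "zpow T k = W k"
proof -
  have nat: "W j ^^ n = W (int n * j)" for j n
    by (induction n) (auto simp: W fun_eq_iff algebra_simps)
  have "inv T = W (- 1)"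
    unfolding T by (rule inv_equality) (simp_all add: W)
  then show ?thesis unfolding zpow_def T by (auto simp: nat)
qed

lemma zpow_genU: "zpow genU k = weyl \<theta> k 0"
  by (rule zpow_eqI) (simp_all add: weyl_U weyl_0 genU_weyl[of \<theta>])
lemma zpow_genV: "zpow (genV \<theta>) k = weyl \<theta> 0 k"
  by (rule zpow_eqI[of "\<lambda>k. weyl \<theta> 0 k"]) (simp_all add: weyl_V weyl_0 genV_weyl[of \<theta>])
lemma zpow_UV: "zpow genU m (zpow (genV \<theta>) n f) = weyl \<theta> m n f"
  by (simp add: zpow_genU[of _ \<theta>] zpow_genV weyl_U)

lemma cinner_weyl: "cinner (weyl \<theta> k l f) g = cinner f (cis (- 2 * pi * \<theta> * of_int (k * l)) *\<^sub>C weyl \<theta> (- k) (- l) g)"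
proof -
  have "bij_betw (\<lambda>(m, n). (m - k, n - l)) (UNIV :: (int \<times> int) set) UNIV"
    by (rule bij_betw_byWitness[where f' = "\<lambda>(m, n). (m + k, n + l)"]) auto
  note R = infsum_reindex_bij_betw[OF this, of "\<lambda>i. cnj (coord f i) * coord (cis (- 2 * pi * \<theta> * of_int (k * l)) *\<^sub>C weyl \<theta> (- k) (- l) g) i"]
  have E: "cnj (cis (- (2 * pi * \<theta> * (real_of_int l * (real_of_int m - real_of_int k))))) =
    cis (- (2 * pi * \<theta> * (real_of_int k * real_of_int l))) * cis (2 * pi * \<theta> * (real_of_int l * real_of_int m))"
    for m :: int by (simp add: cis_mult cis_cnj algebra_simps)
  show ?thesis unfolding cinner_def R[symmetric]
    by (rule infsum_cong) (auto simp: coord_weyl E)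
qed

lemma cinner_zero_right [simp]: "cinner f 0 = 0"
  by (simp add: cinner_def)
lemma cinner_add_right: "cinner f (g + h) = cinner f g + cinner f h"
  by (metis cinner_add_left cinner_commute complex_cnj_add)

lemma inner_scaleC: "inner (c *\<^sub>C f) g = inner f (cnj c *\<^sub>C g)"
  by (simp add: inner_ell2_def cinner_scaleC_left cinner_scaleC_right)
lemma norm_scaleC: "norm (c *\<^sub>C f) = cmod c * norm f"
proof -
  have "(norm (c *\<^sub>C f))\<^sup>2 = (cmod c * norm f)\<^sup>2"
    unfolding power_mult_distrib norm_ell2_sq by (simp add: norm_mult power_mult_distrib infsum_cmult_right')
  then show ?thesis by simp
qed

lemma norm_weyl: "norm (weyl \<theta> k l f) = norm f"
proof -
  have "weyl \<theta> (-k) (-l) (weyl \<theta> k l f) = cis (2 * pi * \<theta> * of_int (k * l)) *\<^sub>C f"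
    by (rule ell2_eqI2) (simp add: coord_weyl mult.assoc[symmetric] cis_mult, simp add: algebra_simps)
  then have "cinner (weyl \<theta> k l f) (weyl \<theta> k l f) = cinner f f"
    by (simp add: cinner_weyl cinner_scaleC_right mult.assoc[symmetric] cis_mult)
  then show ?thesis by (simp add: norm_ell2_def inner_ell2_def)
qed

lemma inner_weyl: "inner (weyl \<theta> k l f) g = inner f (cis (- 2 * pi * \<theta> * of_int (k * l)) *\<^sub>C weyl \<theta> (- k) (- l) g)"
  by (simp add: inner_ell2_def cinner_weyl)

lemma summable_inv_square_int: "(\<lambda>m. 1 / (1 + \<bar>real_of_int m\<bar>)\<^sup>2) summable_on (UNIV :: int set)"
proof -
  let ?f = "\<lambda>m::int. 1 / (1 + \<bar>real_of_int m\<bar>)\<^sup>2"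
  have s: "summable (\<lambda>n::nat. 1 / (1 + real n)\<^sup>2)"
    using summable_Suc_iff[of "\<lambda>n. inverse (real n ^ 2)"] inverse_power_summable[of 2]
    by (simp add: inverse_eq_divide)
  then have "(\<lambda>n::nat. 1 / (1 + real n)\<^sup>2) summable_on UNIV"
    by (intro norm_summable_imp_summable_on) simp
  then have "(?f \<circ> int) summable_on UNIV" "(?f \<circ> (\<lambda>n. - int n)) summable_on UNIV"
    by (simp_all add: o_def)
  then have "?f summable_on range int" "?f summable_on range (\<lambda>n. - int n)"
    by (subst summable_on_reindex; simp add: inj_on_def)+
  then have "?f summable_on (range int \<union> range (\<lambda>n. - int n))"
    by (rule summable_on_union)
  moreover have "range int \<union> range (\<lambda>n. - int n) = UNIV"
  proof -
    have "m \<in> range int \<union> range (\<lambda>n. - int n)" for m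
      by (cases m rule: int_cases2) auto
    then show ?thesis by blast
  qed
  ultimately show ?thesis by simp
qed

lemma rapid_summable:
  assumes "rapid a" shows "(\<lambda>i. cmod (a i)) summable_on UNIV"
proof -
  obtain C where C: "\<And>m n. (1 + \<bar>real_of_int m\<bar> + \<bar>real_of_int n\<bar>) ^ 4 * cmod (a (m, n)) \<le> C"
    using assms unfolding rapid_def by blast
  let ?g = "\<lambda>m::int. 1 / (1 + \<bar>real_of_int m\<bar>)\<^sup>2"
  have "(\<lambda>(m, n). ?g m * ?g n) summable_on UNIV \<times> UNIV"
    by (rule summable_on_SigmaI[where g = "\<lambda>m. ?g m * infsum ?g UNIV"])
      (auto intro!: has_sum_cmult_right summable_on_cmult_left summable_inv_square_int has_sum_infsum
        simp del: times_divide_eq_left times_divide_eq_right)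
  then have "(\<lambda>i. C * (case i of (m, n) \<Rightarrow> ?g m * ?g n)) summable_on UNIV"
    by (intro summable_on_cmult_right) simp
  then show ?thesis
  proof (rule summable_on_comparison_test)
    fix i :: "int \<times> int"
    obtain m n where i: "i = (m, n)" by force
    let ?x = "1 + \<bar>real_of_int m\<bar>" and ?y = "1 + \<bar>real_of_int n\<bar>" and ?z = "1 + \<bar>real_of_int m\<bar> + \<bar>real_of_int n\<bar>"
    have "?x\<^sup>2 * ?y\<^sup>2 \<le> ?z\<^sup>2 * ?z\<^sup>2"
      by (intro mult_mono power_mono) auto
    also have "\<dots> = ?z ^ 4" by (simp flip: power_add)
    finally have "?x\<^sup>2 * ?y\<^sup>2 * cmod (a i) \<le> ?z ^ 4 * cmod (a i)"
      by (rule mult_right_mono) simp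
    also have "\<dots> \<le> C" using C i by blast
    finally have le: "cmod (a i) * (?x\<^sup>2 * ?y\<^sup>2) \<le> C" by (simp add: mult.commute)
    have "0 < ?x\<^sup>2 * ?y\<^sup>2"
      by (intro mult_pos_pos zero_less_power) auto
    with le have "cmod (a i) \<le> C / (?x\<^sup>2 * ?y\<^sup>2)"
      by (simp only: pos_le_divide_eq)
    then show "cmod (a i) \<le> C * (case i of (m, n) \<Rightarrow> ?g m * ?g n)"
      by (simp add: i)
  qed simp
qed

lemma bounded_linear_coord: "bounded_linear (\<lambda>f. coord f i)"
  by (rule bounded_linear_intro[where K = 1]) (auto simp: coord_le_norm scaleR_conv_of_real)

lemma bounded_linear_scaleC: "bounded_linear (\<lambda>f. c *\<^sub>C f)"
  by (rule bounded_linear_intro[where K = "cmod c"])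
    (auto simp: norm_scaleC mult.commute intro!: ell2_eqI simp: algebra_simps)

lemma smooth_torus_vac:
  assumes "((\<lambda>(m, n). a (m, n) *\<^sub>C zpow genU m (zpow (genV \<theta>) n vac)) has_sum y) UNIV"
  shows "coord y = a"
proof
  fix i :: "int \<times> int"
  obtain p q where i: "i = (p, q)" by force
  have "((\<lambda>(m, n). if (m, n) = i then a i else 0) has_sum coord y i) UNIV"
    using has_sum_bounded_linear[OF bounded_linear_coord[of i] assms]
    by (rule has_sum_cong[THEN iffD1, rotated])
      (auto simp: i zpow_UV coord_weyl coord_ket)
  moreover have "((\<lambda>(m, n). if (m, n) = i then a i else 0) has_sum a i) UNIV"
    by (rule has_sum_finite_neutralI[where B = "{i}"]) (auto simp: i split: if_splits)
  ultimately show "coord y i = a i" using has_sum_unique by blast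
qed

lemma smooth_torus_adjoint:
  assumes "rapid a"
    and T: "\<And>f. ((\<lambda>(m, n). a (m, n) *\<^sub>C zpow genU m (zpow (genV \<theta>) n f)) has_sum T f) UNIV"
  shows "((\<lambda>(m, n). (cis (- 2 * pi * \<theta> * of_int (m * n)) * cnj (a (- m, - n))) *\<^sub>C
    zpow genU m (zpow (genV \<theta>) n g)) has_sum adjoint T g) UNIV"
    and "inner (T f) g = inner f (adjoint T g)"
proof -
  let ?b = "\<lambda>m n. (cis (- 2 * pi * \<theta> * of_int (m * n)) * cnj (a (- m, - n)))"
  let ?c = "\<lambda>m n. cnj (a (m, n)) * cis (- 2 * pi * \<theta> * of_int (m * n))"
  have bij: "bij_betw (\<lambda>(m, n). (- m, - n)) (UNIV :: (int \<times> int) set) UNIV"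
    by (rule bij_betw_byWitness[where f' = "\<lambda>(m, n). (- m, - n)"]) auto
  define T' where "T' g = infsum (\<lambda>(m, n). ?c m n *\<^sub>C weyl \<theta> (- m) (- n) g) UNIV" for g
  have T': "((\<lambda>(m, n). ?c m n *\<^sub>C weyl \<theta> (- m) (- n) g) has_sum T' g) UNIV" for g
  proof -
    have "(\<lambda>i. norm (case i of (m, n) \<Rightarrow> ?c m n *\<^sub>C weyl \<theta> (- m) (- n) g)) summable_on UNIV"
      using summable_on_cmult_left[OF rapid_summable[OF assms(1)], of "norm g"]
      by (simp add: case_prod_unfold norm_scaleC norm_weyl norm_mult)
    then have "(\<lambda>(m, n). ?c m n *\<^sub>C weyl \<theta> (- m) (- n) g) summable_on UNIV"
      by (rule abs_summable_summable)
    then show ?thesis unfolding T'_def by (rule has_sum_infsum)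
  qed
  have adj: "inner (T f) g = inner f (T' g)" for f g
  proof (rule has_sum_unique)
    show "((\<lambda>i. inner (case i of (m, n) \<Rightarrow> a (m, n) *\<^sub>C zpow genU m (zpow (genV \<theta>) n f)) g)
      has_sum inner (T f) g) UNIV"
      using has_sum_bounded_linear[OF bounded_linear_inner_left[of g] T[of f]] .
    have "inner (case i of (m, n) \<Rightarrow> a (m, n) *\<^sub>C zpow genU m (zpow (genV \<theta>) n f)) g =
        inner f (case i of (m, n) \<Rightarrow> ?c m n *\<^sub>C weyl \<theta> (- m) (- n) g)" for i
      by (cases i) (simp add: zpow_UV inner_ell2_def cinner_weyl cinner_scaleC_left
          cinner_scaleC_right algebra_simps)
    then show "((\<lambda>i. inner (case i of (m, n) \<Rightarrow> a (m, n) *\<^sub>C zpow genU m (zpow (genV \<theta>) n f)) g)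
      has_sum inner f (T' g)) UNIV"
      by (simp only:) (rule has_sum_bounded_linear[OF bounded_linear_inner_right[of f] T'[of g]])
  qed
  then have T'_adj: "adjoint T = T'" by (simp add: adjoint_unique)
  show "inner (T f) g = inner f (adjoint T g)" using adj T'_adj by simp
  have "(\<lambda>i. case (case i of (m, n) \<Rightarrow> (- m, - n)) of (m, n) \<Rightarrow> ?b m n *\<^sub>C zpow genU m (zpow (genV \<theta>) n g)) =
      (\<lambda>(m, n). ?c m n *\<^sub>C weyl \<theta> (- m) (- n) g)"
    by (auto simp: zpow_UV mult.commute[of "cis _"])
  with T'[of g] show "((\<lambda>(m, n). ?b m n *\<^sub>C zpow genU m (zpow (genV \<theta>) n g)) has_sum adjoint T g) UNIV"
    unfolding T'_adj by (subst has_sum_reindex_bij_betw[OF bij, symmetric]) (simp only:)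
qed

lemma J0_vac:
  assumes "T \<in> smooth_torus \<theta>" shows "J0 \<theta> (T vac) = adjoint T vac"
proof -
  obtain a where a: "rapid a"
    "\<And>f. ((\<lambda>(m, n). a (m, n) *\<^sub>C zpow genU m (zpow (genV \<theta>) n f)) has_sum T f) UNIV"
    using assms by (auto simp: smooth_torus_def)
  have "((\<lambda>(m, n). (case (m, n) of (m, n) \<Rightarrow> cis (- 2 * pi * \<theta> * of_int (m * n)) * cnj (a (- m, - n))) *\<^sub>C
    zpow genU m (zpow (genV \<theta>) n vac)) has_sum adjoint T vac) UNIV"
    using smooth_torus_adjoint(1)[OF a] by simp
  from smooth_torus_vac[OF this] smooth_torus_vac[OF a(2)] show ?thesis
    by (intro ell2_eqI2) (simp add: coord_J0)
qed

lemma cinner_J0: "cinner (J0 \<theta> f) g = cinner (J0 \<theta> g) f"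
proof -
  have bij: "bij_betw (\<lambda>(m, n). (- m, - n)) (UNIV :: (int \<times> int) set) UNIV"
    by (rule bij_betw_byWitness[where f' = "\<lambda>(m, n). (- m, - n)"]) auto
  show ?thesis unfolding cinner_def infsum_reindex_bij_betw[OF bij, of "\<lambda>i. cnj (coord (J0 \<theta> g) i) * coord f i", symmetric]
    by (rule infsum_cong) (auto simp: coord_J0)
qed

lemma smooth_torus_scaleC:
  assumes "T \<in> smooth_torus \<theta>" shows "T (c *\<^sub>C f) = c *\<^sub>C T f"
proof -
  obtain a where a: "\<And>f. ((\<lambda>(m, n). a (m, n) *\<^sub>C zpow genU m (zpow (genV \<theta>) n f)) has_sum T f) UNIV"
    using assms by (auto simp: smooth_torus_def)
  have w: "weyl \<theta> m n (c *\<^sub>C f) = c *\<^sub>C weyl \<theta> m n f" for m n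
    by (rule ell2_eqI2) (simp add: coord_weyl)
  have "((\<lambda>(m, n). a (m, n) *\<^sub>C zpow genU m (zpow (genV \<theta>) n (c *\<^sub>C f))) has_sum c *\<^sub>C T f) UNIV"
    by (rule has_sum_cong[THEN iffD1, OF _ has_sum_bounded_linear[OF bounded_linear_scaleC[of c] a[of f]]])
      (auto simp: zpow_UV w intro!: ell2_eqI)
  then show ?thesis using a has_sum_unique by blast
qed

lemma smooth_torus_cinner:
  assumes T: "T \<in> smooth_torus \<theta>" shows "cinner (T f) g = cinner f (adjoint T g)"
proof (rule complex_eqI)
  have adj: "inner (T f) g = inner f (adjoint T g)" for f g
    using T smooth_torus_adjoint(2) unfolding smooth_torus_def by blast
  show "Re (cinner (T f) g) = Re (cinner f (adjoint T g))"
    using adj by (simp add: inner_ell2_def)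
  have "inner (\<i> *\<^sub>C T f) g = inner (\<i> *\<^sub>C f) (adjoint T g)"
    unfolding smooth_torus_scaleC[OF T, symmetric] by (rule adj)
  then show "Im (cinner (T f) g) = Im (cinner f (adjoint T g))"
    by (simp add: inner_ell2_def cinner_scaleC_left)
qed

lemma vac_tracial:
  assumes S: "S \<in> smooth_torus \<theta>" and T: "T \<in> smooth_torus \<theta>"
  shows "cinner vac (S (T vac)) = cinner vac (T (S vac))"
proof -
  have sw: "cinner vac (S (T vac)) = cinner (J0 \<theta> (S vac)) (T vac)"
    if S: "S \<in> smooth_torus \<theta>" for S T
    using smooth_torus_cinner[OF S, of "T vac" vac] J0_vac[OF S] cinner_commute by metis
  show ?thesis using sw[OF S] sw[OF T] cinner_J0 by metis
qed

lemma ket_has_sum: "((\<lambda>i. coord f i *\<^sub>C ket i) has_sum f) UNIV"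
proof -
  have fin: "(norm (f - (\<Sum>i\<in>F. coord f i *\<^sub>C ket i)))\<^sup>2 = (norm f)\<^sup>2 - (\<Sum>i\<in>F. (cmod (coord f i))\<^sup>2)"
    if "finite F" for F
  proof -
    have c: "coord (\<Sum>i\<in>F. coord f i *\<^sub>C ket i) j = (if j \<in> F then coord f j else 0)" for j
    proof -
      have "coord (\<Sum>i\<in>F. coord f i *\<^sub>C ket i) j = (\<Sum>i\<in>F. coord (coord f i *\<^sub>C ket i) j)"
        using \<open>finite F\<close> by (induction F) auto
      then show ?thesis using that by (simp add: coord_ket if_distrib[of "(*) _"] cong: if_cong)
    qed
    have "((\<lambda>i. (cmod (coord f i))\<^sup>2 - (if i \<in> F then (cmod (coord f i))\<^sup>2 else 0)) has_sum
      ((norm f)\<^sup>2 - (\<Sum>i\<in>F. (cmod (coord f i))\<^sup>2))) UNIV"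
      unfolding diff_conv_add_uminus norm_ell2_sq
      by (intro has_sum_add has_sum_infsum coord_summable has_sum_uminus[THEN iffD2])
        (rule has_sum_finite_neutralI[where B = F], use that in auto)
    then show ?thesis
      unfolding norm_ell2_sq[of "f - _"] 
      by (intro infsumI) (erule has_sum_cong[THEN iffD1, rotated], auto simp: c)
  qed
  have "((\<lambda>F. (norm f)\<^sup>2 - (\<Sum>i\<in>F. (cmod (coord f i))\<^sup>2)) \<longlongrightarrow> (norm f)\<^sup>2 - (norm f)\<^sup>2) (finite_subsets_at_top UNIV)"
    unfolding norm_ell2_sq using infsum_tendsto[OF coord_summable[of f]] by (intro tendsto_diff tendsto_const)
  then have "((\<lambda>F. (norm (f - (\<Sum>i\<in>F. coord f i *\<^sub>C ket i)))\<^sup>2) \<longlongrightarrow> 0) (finite_subsets_at_top UNIV)"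
    unfolding diff_self
    by (rule Lim_transform_eventually) (intro eventually_finite_subsets_at_top_weakI, simp add: fin)
  then have "((\<lambda>F. sqrt ((norm (f - (\<Sum>i\<in>F. coord f i *\<^sub>C ket i)))\<^sup>2)) \<longlongrightarrow> sqrt 0) (finite_subsets_at_top UNIV)"
    by (rule tendsto_real_sqrt)
  then have "((\<lambda>F. dist (\<Sum>i\<in>F. coord f i *\<^sub>C ket i) f) \<longlongrightarrow> 0) (finite_subsets_at_top UNIV)"
    by (simp add: dist_norm norm_minus_commute)
  then show ?thesis unfolding has_sum_def by (rule tendsto_dist_iff[THEN iffD2])
qed

lemma rapid_finite:
  assumes "finite F" "\<And>i. i \<notin> F \<Longrightarrow> a i = 0" shows "rapid a"
  unfolding rapid_def
proof (intro allI)
  fix k :: nat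
  let ?g = "\<lambda>(m, n). (1 + \<bar>real_of_int m\<bar> + \<bar>real_of_int n\<bar>) ^ k * cmod (a (m, n))"
  have "?g i \<le> sum ?g F" for i
  proof (cases "i \<in> F")
    case True
    then show ?thesis by (intro member_le_sum) (use assms in auto)
  next
    case False
    then have "?g i = 0" using assms(2) by (simp add: case_prod_unfold)
    then show ?thesis by (simp only:) (rule sum_nonneg, auto)
  qed
  then show "\<exists>C. \<forall>m n. (1 + \<bar>real_of_int m\<bar> + \<bar>real_of_int n\<bar>) ^ k * cmod (a (m, n)) \<le> C"
    by fastforce
qed

lemma weyl_vac: "weyl \<theta> m n vac = ket (m, n)"
  by (rule ell2_eqI2) (auto simp: coord_weyl coord_ket)

lemma vac_cyclic: "closure ((\<lambda>T. T vac) ` smooth_torus \<theta>) = UNIV"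
proof -
  have mem: "(\<Sum>i\<in>F. coord f i *\<^sub>C ket i) \<in> (\<lambda>T. T vac) ` smooth_torus \<theta>" if "finite F" for f F
  proof (rule image_eqI)
    let ?a = "\<lambda>i. if i \<in> F then coord f i else 0"
    let ?T = "\<lambda>g. \<Sum>i\<in>F. coord f i *\<^sub>C weyl \<theta> (fst i) (snd i) g"
    show "(\<Sum>i\<in>F. coord f i *\<^sub>C ket i) = ?T vac"
      by (simp add: weyl_vac)
    have "((\<lambda>(m, n). ?a (m, n) *\<^sub>C zpow genU m (zpow (genV \<theta>) n g)) has_sum ?T g) UNIV" for g
      by (rule has_sum_finite_neutralI[where B = F])
        (use that in \<open>auto simp: zpow_UV case_prod_unfold intro!: ell2_eqI\<close>)
    moreover have "rapid ?a" using rapid_finite[OF that] by simp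
    ultimately show "?T \<in> smooth_torus \<theta>" unfolding smooth_torus_def by blast
  qed
  have "f \<in> closure ((\<lambda>T. T vac) ` smooth_torus \<theta>)" for f
  proof (rule Lim_in_closed_set)
    show "((\<lambda>F. \<Sum>i\<in>F. coord f i *\<^sub>C ket i) \<longlongrightarrow> f) (finite_subsets_at_top UNIV)"
      using ket_has_sum[of f] unfolding has_sum_def .
    show "\<forall>\<^sub>F F in finite_subsets_at_top UNIV.
      (\<Sum>i\<in>F. coord f i *\<^sub>C ket i) \<in> closure ((\<lambda>T. T vac) ` smooth_torus \<theta>)"
      by (rule eventually_finite_subsets_at_top_weakI) (use mem closure_subset in blast)
  qed simp_all
  then show ?thesis by blast
qed

(* The tensor product of the GNS space with C^2, as a direct sum of two copies. *)
type_synonym spinor = "tau_space \<times> tau_space"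

definition spin :: "(tau_space \<Rightarrow> tau_space) \<Rightarrow> spinor \<Rightarrow> spinor"
  where "spin T = (\<lambda>(x, y). (T x, T y))"

definition sigma1 :: "spinor \<Rightarrow> spinor" where "sigma1 = (\<lambda>(x, y). (y, x))"
definition sigma2 :: "spinor \<Rightarrow> spinor" where "sigma2 = (\<lambda>(x, y). (- \<i> *\<^sub>C y, \<i> *\<^sub>C x))"

(* i sigma2 is the matrix ((0, 1), (-1, 0)), and J0 is already antilinear. *)
definition Jop :: "real \<Rightarrow> spinor \<Rightarrow> spinor"
  where "Jop \<theta> = (\<lambda>(x, y). (J0 \<theta> y, - J0 \<theta> x))"

definition torus :: "real \<Rightarrow> (spinor \<Rightarrow> spinor) set"
  where "torus \<theta> = spin ` smooth_torus \<theta>"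

(* Unbounded operators are represented by their graphs. *)
type_synonym graph = "(spinor \<times> spinor) set"

definition spin_graph :: "(tau_space \<times> tau_space) set \<Rightarrow> graph"
  where "spin_graph T = {((x, y), (x', y')). (x, x') \<in> T \<and> (y, y') \<in> T}"

(* The maximal domain, i.e. all v whose image is again square summable; this is the domain of
   selfadjointness. *)
definition delta1 :: graph
  where "delta1 = spin_graph {(f, g). \<forall>m n. coord g (m, n) = of_int m * coord f (m, n)}"

definition delta2 :: graph
  where "delta2 = spin_graph {(f, g). \<forall>m n. coord g (m, n) = of_int n * coord f (m, n)}"

definition dirac :: graph
  where "dirac = {(v, sigma1 x + sigma2 y) | v x y. (v, x) \<in> delta1 \<and> (v, y) \<in> delta2}"

(* (1/2) Gamma [Gamma, D] with Gamma = sigma2; see lemma dirac_h for the form sigma1 delta1. *)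
definition dirac_h :: graph
  where "dirac_h = {(v, (1/2) *\<^sub>R sigma2 (sigma2 w - w')) | v w w'.
    (v, w) \<in> dirac \<and> (sigma2 v, w') \<in> dirac}"

(* The bounded operator extending [T, a] from the domain of T, where a has to preserve that domain.
   In particular commutator delta2 a is the derivation delta2(a); compare lemma delta_generators. *)
definition commutator :: "graph \<Rightarrow> (spinor \<Rightarrow> spinor) \<Rightarrow> spinor \<Rightarrow> spinor"
  where "commutator T a = (THE S. bounded_linear S \<and> (\<forall>(v, w)\<in>T. (a v, S v + a w) \<in> T))"

definition torus_deg :: "real \<Rightarrow> int \<Rightarrow> (spinor \<Rightarrow> spinor) set"
  where "torus_deg \<theta> k = {a \<in> torus \<theta>. commutator delta2 a = (\<lambda>v. of_int k *\<^sub>R a v)}"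

abbreviation base :: "real \<Rightarrow> (spinor \<Rightarrow> spinor) set" where "base \<theta> \<equiv> torus_deg \<theta> 0"

(* Finite sums give the complex span, since the algebras in use are closed under complex scalars. *)
definition one_forms :: "(spinor \<Rightarrow> spinor) set \<Rightarrow> (spinor \<Rightarrow> spinor) set"
  where "one_forms X = {(\<lambda>v. \<Sum>i<n. p i (commutator dirac (q i) v)) | (n::nat) p q. \<forall>i<n. p i \<in> X \<and> q i \<in> X}"

definition base_forms_torus :: "real \<Rightarrow> (spinor \<Rightarrow> spinor) set"
  where "base_forms_torus \<theta> = {(\<lambda>v. \<Sum>i<n. \<eta> i (a i v)) | (n::nat) \<eta> a.
    \<forall>i<n. \<eta> i \<in> one_forms (base \<theta>) \<and> a i \<in> torus \<theta>}"

definition nabla :: "(spinor \<Rightarrow> spinor) \<Rightarrow> (spinor \<Rightarrow> spinor) \<Rightarrow> spinor \<Rightarrow> spinor"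
  where "nabla \<omega> a = (\<lambda>v. commutator dirac a v - commutator delta2 a (\<omega> v))"

definition strong_connection :: "real \<Rightarrow> (spinor \<Rightarrow> spinor) \<Rightarrow> bool"
  where "strong_connection \<theta> \<omega> \<longleftrightarrow>
    \<omega> \<in> one_forms (torus \<theta>) \<and>
    (\<forall>(v, w)\<in>delta2. (\<omega> v, \<omega> w) \<in> delta2) \<and>
    (\<forall>(n::nat) p q. (\<forall>i<n. p i \<in> torus \<theta> \<and> q i \<in> torus \<theta>) \<and>
        \<omega> = (\<lambda>v. \<Sum>i<n. p i (commutator dirac (q i) v)) \<longrightarrow>
      (\<lambda>v. \<Sum>i<n. p i (commutator delta2 (q i) v)) = (\<lambda>v. v)) \<and>
    (\<forall>a\<in>torus \<theta>. nabla \<omega> a \<in> base_forms_torus \<theta>)"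

(* The right action h a = J a* J^(-1) h. *)
definition ract :: "real \<Rightarrow> spinor \<Rightarrow> (spinor \<Rightarrow> spinor) \<Rightarrow> spinor"
  where "ract \<theta> h a = Jop \<theta> (adjoint a (inv (Jop \<theta>) h))"

(* h xi for xi in Omega^1_D(B) A: h (b' [D, b]) = [D, J b* J^(-1)] (h b') and
   h (eta a) = (h eta) a, extended additively. Here J b* J^(-1) is x |-> ract x b. *)
definition ract_form :: "real \<Rightarrow> spinor \<Rightarrow> (spinor \<Rightarrow> spinor) \<Rightarrow> spinor"
  where "ract_form \<theta> h \<xi> = (THE w. \<exists>(n::nat) b' b a.
    (\<forall>i<n. b' i \<in> base \<theta> \<and> b i \<in> base \<theta> \<and> a i \<in> torus \<theta>) \<and>
    \<xi> = (\<lambda>v. \<Sum>i<n. b' i (commutator dirac (b i) (a i v))) \<and>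
    w = (\<Sum>i<n. ract \<theta> (commutator dirac (\<lambda>x. ract \<theta> x (b i)) (ract \<theta> h (b' i))) (a i)))"

(* Real and complex span coincide here, as the set of generating pairs is closed under complex
   multiples of h. *)
definition twisted_dirac :: "real \<Rightarrow> (spinor \<Rightarrow> spinor) \<Rightarrow> graph"
  where "twisted_dirac \<theta> \<omega> = span {(ract \<theta> h a, ract \<theta> w a + ract_form \<theta> h (nabla \<omega> a)) | h w a.
    (h, 0) \<in> delta2 \<and> (h, w) \<in> dirac_h \<and> (\<exists>k. a \<in> torus_deg \<theta> k)}"

definition compatible :: "real \<Rightarrow> (spinor \<Rightarrow> spinor) \<Rightarrow> bool"
  where "compatible \<theta> \<omega> \<longleftrightarrow>
    (\<exists>S. closure S = UNIV \<and> (\<forall>v\<in>S. \<exists>w. (v, w) \<in> twisted_dirac \<theta> \<omega> \<and> (v, w) \<in> dirac_h))"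

lemma single_valued_delta: "single_valued delta1" "single_valued delta2"
  by (auto simp: single_valued_def delta1_def delta2_def spin_graph_def intro!: ell2_eqI2)

lemma coord_sum: "coord (\<Sum>i\<in>F. f i) j = (\<Sum>i\<in>F. coord (f i) j)"
  by (induction F rule: infinite_finite_induct) auto

lemma dense_delta: "closure (Domain delta1 \<inter> Domain delta2) = UNIV"
proof -
  let ?S = "{f :: tau_space. finite {i. coord f i \<noteq> 0}}"
  have mult: "\<exists>g. \<forall>i. coord g i = c i * coord f i" if "f \<in> ?S" for f c
    by (rule exI[of _ "\<Sum>j\<in>{i. coord f i \<noteq> 0}. (c j * coord f j) *\<^sub>C ket j"])
      (use that in \<open>auto simp: coord_sum coord_ket if_distrib[of "(*) _"] cong: if_cong\<close>)
  have m1: "\<exists>g. \<forall>m n. coord g (m, n) = of_int m * coord f (m, n)" if "f \<in> ?S" for f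
    using mult[OF that, of "\<lambda>i. of_int (fst i)"] by auto
  have m2: "\<exists>g. \<forall>m n. coord g (m, n) = of_int n * coord f (m, n)" if "f \<in> ?S" for f
    using mult[OF that, of "\<lambda>i. of_int (snd i)"] by auto
  have sub: "?S \<times> ?S \<subseteq> Domain delta1 \<inter> Domain delta2"
    using m1 m2 by (fastforce simp: delta1_def delta2_def spin_graph_def)
  have "f \<in> closure ?S" for f
  proof (rule Lim_in_closed_set)
    show "((\<lambda>F. \<Sum>i\<in>F. coord f i *\<^sub>C ket i) \<longlongrightarrow> f) (finite_subsets_at_top UNIV)"
      using ket_has_sum[of f] unfolding has_sum_def .
    have "(\<Sum>i\<in>F. coord f i *\<^sub>C ket i) \<in> ?S" if "finite F" for F
    proof -
      have "{j. coord (\<Sum>i\<in>F. coord f i *\<^sub>C ket i) j \<noteq> 0} \<subseteq> F"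
        by (auto simp: coord_sum coord_ket elim!: sum.not_neutral_contains_not_neutral split: if_splits)
      then show ?thesis using finite_subset[OF _ that] by blast
    qed
    then show "\<forall>\<^sub>F F in finite_subsets_at_top UNIV. (\<Sum>i\<in>F. coord f i *\<^sub>C ket i) \<in> closure ?S"
      by (intro eventually_finite_subsets_at_top_weakI) (use closure_subset in blast)
  qed simp_all
  then have "closure (?S \<times> ?S) = UNIV" by (auto simp: closure_Times)
  then show ?thesis using closure_mono[OF sub] by auto
qed

lemma dense_Domain_delta: "closure (Domain delta1) = UNIV" "closure (Domain delta2) = UNIV"
  using dense_delta closure_mono[of "Domain delta1 \<inter> Domain delta2"] by blast+

lemma commutator_eqI:
  assumes "single_valued T" "closure (Domain T) = UNIV" "bounded_linear S"
    and S: "\<And>v w. (v, w) \<in> T \<Longrightarrow> (a v, S v + a w) \<in> T"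
  shows "commutator T a = S"
  unfolding commutator_def
proof (rule the_equality)
  show "bounded_linear S \<and> (\<forall>(v, w)\<in>T. (a v, S v + a w) \<in> T)" using assms by auto
  fix S' assume S': "bounded_linear S' \<and> (\<forall>(v, w)\<in>T. (a v, S' v + a w) \<in> T)"
  have "closed {v. S' v = S v}"
    using S' assms(3) by (intro closed_Collect_eq linear_continuous_on) auto
  moreover have "S' v = S v" if "(v, w) \<in> T" for v w
  proof -
    have "(a v, S' v + a w) \<in> T" using S' that by blast
    then have "S' v + a w = S v + a w" using single_valuedD[OF assms(1)] S[OF that] by blast
    then show ?thesis by simp
  qed
  then have "Domain T \<subseteq> {v. S' v = S v}" by blast
  ultimately have "closure (Domain T) \<subseteq> {v. S' v = S v}" by (rule closure_minimal[rotated])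
  then show "S' = S" using assms(2) by auto
qed

lemma bounded_linear_weyl: "bounded_linear (weyl \<theta> k l)"
  by (rule bounded_linear_intro[where K = 1])
    (auto simp: norm_weyl coord_weyl algebra_simps intro!: ell2_eqI2)

lemma bounded_linear_spin:
  assumes "bounded_linear T" shows "bounded_linear (spin T)"
proof -
  have "spin T = (\<lambda>v. (T (fst v), T (snd v)))" by (auto simp: spin_def)
  then show ?thesis
    using bounded_linear_Pair[OF bounded_linear_compose[OF assms bounded_linear_fst]
        bounded_linear_compose[OF assms bounded_linear_snd]] by (simp only:)
qed

lemma delta_generators:
  "commutator delta1 (spin genU) = spin genU" "commutator delta1 (spin (genV \<theta>)) = (\<lambda>v. 0)"
  "commutator delta2 (spin genU) = (\<lambda>v. 0)" "commutator delta2 (spin (genV \<theta>)) = spin (genV \<theta>)"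
  by (rule commutator_eqI[OF single_valued_delta(1) dense_Domain_delta(1)]
        commutator_eqI[OF single_valued_delta(2) dense_Domain_delta(2)],
      simp add: bounded_linear_spin bounded_linear_weyl genU_weyl[of 0] genV_weyl,
      force simp: delta1_def delta2_def spin_graph_def spin_def coord_genU coord_genV algebra_simps)+

lemma dirac_h: "dirac_h = {(v, sigma1 w) | v w. (v, w) \<in> delta1 \<and> v \<in> Domain delta2}"
proof -
  have mult: "(sigma2 v, sigma2 w) \<in> delta1 \<longleftrightarrow> (v, w) \<in> delta1"
    "(sigma2 v, sigma2 w) \<in> delta2 \<longleftrightarrow> (v, w) \<in> delta2" for v w
    by (auto simp: delta1_def delta2_def spin_graph_def sigma2_def split: prod.splits)
  have alg: "(1/2) *\<^sub>R sigma2 (sigma2 (sigma1 x + sigma2 y) - (sigma1 (sigma2 x) + sigma2 (sigma2 y))) = sigma1 x" for x y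
    by (cases x; cases y) (auto simp: sigma1_def sigma2_def algebra_simps intro!: ell2_eqI)
  have diracI: "(v, sigma1 x + sigma2 y) \<in> dirac" if "(v, x) \<in> delta1" "(v, y) \<in> delta2" for v x y
    using that unfolding dirac_def by blast
  show ?thesis
  proof (intro equalityI subsetI)
    fix z assume "z \<in> dirac_h"
    then obtain v x y x' y' where z: "z = (v, (1/2) *\<^sub>R sigma2 (sigma2 (sigma1 x + sigma2 y) - (sigma1 x' + sigma2 y')))"
      and xy: "(v, x) \<in> delta1" "(v, y) \<in> delta2" "(sigma2 v, x') \<in> delta1" "(sigma2 v, y') \<in> delta2"
      unfolding dirac_h_def dirac_def by blast
    have "x' = sigma2 x" "y' = sigma2 y"
      using xy mult single_valued_delta unfolding single_valued_def by blast+
    then have "z = (v, sigma1 x)" using z alg by simp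
    then show "z \<in> {(v, sigma1 w) | v w. (v, w) \<in> delta1 \<and> v \<in> Domain delta2}"
      using xy by blast
  next
    fix z assume "z \<in> {(v, sigma1 w) | v w. (v, w) \<in> delta1 \<and> v \<in> Domain delta2}"
    then obtain v x y where z: "z = (v, sigma1 x)" and xy: "(v, x) \<in> delta1" "(v, y) \<in> delta2" by auto
    have "(v, sigma1 x + sigma2 y) \<in> dirac" "(sigma2 v, sigma1 (sigma2 x) + sigma2 (sigma2 y)) \<in> dirac"
      by (rule diracI; simp add: mult xy)+
    then have "(v, (1/2) *\<^sub>R sigma2 (sigma2 (sigma1 x + sigma2 y) - (sigma1 (sigma2 x) + sigma2 (sigma2 y)))) \<in> dirac_h"
      unfolding dirac_h_def by blast
    then show "z \<in> dirac_h" unfolding alg z .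
  qed
qed

end

theory Submission
  imports Defs
begin

text \<open>Write \<open>D\<^sub>1 a\<close>, \<open>D\<^sub>2 a\<close> for the commutators of \<open>a\<close> with \<open>delta1\<close>, \<open>delta2\<close>. Since
  \<open>[D, a] = sigma1 (D\<^sub>1 a) + sigma2 (D\<^sub>2 a)\<close> and the Pauli matrices are linearly independent over the
  algebra, a one-form has unique components in front of \<open>sigma1\<close> and \<open>sigma2\<close>. For a strong connection
  the normalisation on vertical fields says that the component in front of \<open>sigma2\<close> is \<open>1\<close>, and
  invariance under \<open>delta2\<close> says that the other one has degree zero; so the strong
  connections have the form \<open>\<omega> = sigma1 \<alpha> + sigma2\<close> with \<open>\<alpha>\<close> in the base algebra
  (\<open>strong_connectionE\<close>).

  For such \<open>\<omega>\<close> the covariant derivative \<open>\<nabla> a = sigma1 (D\<^sub>1 a - (D\<^sub>2 a) \<alpha>)\<close> is \<open>sigma1\<close> times an element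
  of the algebra, and \<open>sigma1 = U\<^sup>-\<^sup>1 [D, U]\<close> acts from the right on spinors as \<open>sigma1\<close> itself
  (\<open>ract_form_sigma1\<close>). By the Leibniz rule the twisted Dirac operator is therefore
  \<open>v \<mapsto> sigma1 (delta1 v - (delta2 v) \<alpha>)\<close> on the vectors where it is defined
  (\<open>twisted_dirac_subset\<close>), so that it differs from \<open>dirac_h = sigma1 delta1\<close> by the vertical term
  \<open>(delta2 v) \<alpha>\<close>.

  If both operators agree on a dense set, that term vanishes there. Right multiplication by \<open>\<alpha>\<close>
  preserves the degree, and on degree one \<open>delta2\<close> is the identity; so the degree-one part of
  \<open>v \<alpha>\<close> vanishes for \<open>v\<close> in a dense set, hence by continuity for \<open>v = V vac\<close>, which gives \<open>\<alpha> = 0\<close>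
  (\<open>base_eq_0\<close>). Conversely, for \<open>\<alpha> = 0\<close> the twisted operator is a restriction of \<open>dirac_h\<close>, and its
  domain contains the linear span of the basis vectors.

  The analysis behind this is elementary Fourier analysis on \<open>\<int>\<^sup>2\<close>. Left and right multiplications are
  both series of twisted translations of \<open>\<int>\<^sup>2\<close> with rapidly decreasing coefficients, so one locale treats
  their boundedness and their Leibniz rules; that the algebra is closed under products follows
  because left multiplications commute with right translations and the vacuum is cyclic.\<close>

section \<open>Rapidly decreasing coefficients\<close>

abbreviation weight :: "int \<times> int \<Rightarrow> real"
  where "weight i \<equiv> 1 + \<bar>real_of_int (fst i)\<bar> + \<bar>real_of_int (snd i)\<bar>"

lemma rapid_iff: "rapid a \<longleftrightarrow> (\<forall>k. \<exists>C. \<forall>i. weight i ^ k * cmod (a i) \<le> C)"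
  by (simp add: rapid_def split_paired_All)

lemma rapid_mono:
  assumes "rapid a" "0 \<le> C" and b: "\<And>i. cmod (b i) \<le> C * weight i ^ j * cmod (a i)"
  shows "rapid b"
  unfolding rapid_iff
proof
  fix k
  obtain B where B: "\<And>i. weight i ^ (k + j) * cmod (a i) \<le> B"
    using assms(1) unfolding rapid_iff by blast
  have "weight i ^ k * cmod (b i) \<le> C * B" for i
  proof -
    have "weight i ^ k * cmod (b i) \<le> weight i ^ k * (C * weight i ^ j * cmod (a i))"
      by (rule mult_left_mono[OF b]) simp
    also have "\<dots> = C * (weight i ^ (k + j) * cmod (a i))"
      by (simp add: power_add)
    also have "\<dots> \<le> C * B" by (rule mult_left_mono[OF B \<open>0 \<le> C\<close>])
    finally show ?thesis .
  qed
  then show "\<exists>C. \<forall>i. weight i ^ k * cmod (b i) \<le> C" by blast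
qed

lemma rapid_add:
  assumes "rapid a" "rapid b" shows "rapid (\<lambda>i. a i + b i)"
  unfolding rapid_iff
proof
  fix k
  obtain A B where AB: "\<And>i. weight i ^ k * cmod (a i) \<le> A" "\<And>i. weight i ^ k * cmod (b i) \<le> B"
    using assms unfolding rapid_iff by blast
  have "weight i ^ k * cmod (a i + b i) \<le> A + B" for i
  proof -
    have "weight i ^ k * cmod (a i + b i) \<le> weight i ^ k * (cmod (a i) + cmod (b i))"
      by (rule mult_left_mono[OF norm_triangle_ineq]) simp
    then show ?thesis using AB[of i] by (simp add: distrib_left)
  qed
  then show "\<exists>C. \<forall>i. weight i ^ k * cmod (a i + b i) \<le> C" by blast
qed

lemma rapid_scale: "rapid a \<Longrightarrow> rapid (\<lambda>i. c * a i)"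
  by (rule rapid_mono[of a "cmod c" _ 0]) (simp_all add: norm_mult)

lemma rapid_fst: "rapid a \<Longrightarrow> rapid (\<lambda>i. of_int (fst i) * a i)"
  and rapid_snd: "rapid a \<Longrightarrow> rapid (\<lambda>i. of_int (snd i) * a i)"
  by (rule rapid_mono[of a 1 _ 1]; auto simp: norm_mult mult_right_mono)+

lemma rapid_weight: "rapid a \<Longrightarrow> rapid (\<lambda>i. of_real (weight i ^ k) * a i)"
  by (rule rapid_mono[of a 1 _ k]) (simp_all add: norm_mult norm_power del: of_real_add)

text \<open>Peetre's inequality \<open>weight j \<le> weight i * weight (j - i)\<close> distributes the weight over the two
  factors of a twisted convolution.\<close>

lemma weight_le_mult: "weight j \<le> weight i * weight (j - i)"
proof -
  have "weight j \<le> weight i + (\<bar>real_of_int (fst (j - i))\<bar> + \<bar>real_of_int (snd (j - i))\<bar>)"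
    by simp
  also have "\<dots> \<le> weight i + weight i * (\<bar>real_of_int (fst (j - i))\<bar> + \<bar>real_of_int (snd (j - i))\<bar>)"
    using mult_right_mono[of 1 "weight i" "\<bar>real_of_int (fst (j - i))\<bar> + \<bar>real_of_int (snd (j - i))\<bar>"] by simp
  also have "\<dots> = weight i * weight (j - i)"
    by (simp add: algebra_simps)
  finally show ?thesis .
qed

text \<open>Multiplying the convolution by \<open>weight j ^ k\<close> and splitting the weight leaves the
  summable sequence \<open>weight i ^ k * cmod (a i)\<close> against a bounded one.\<close>

lemma rapid_twisted_convolution:
  assumes a: "rapid a" and b: "rapid b" and u: "\<And>i j. cmod (u i j) = 1"
    and c: "\<And>j. ((\<lambda>i. a i * (u i j * b (j - i))) has_sum c j) UNIV"
  shows "rapid c"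
  unfolding rapid_iff
proof
  fix k
  obtain B where B: "\<And>i. weight i ^ k * cmod (b i) \<le> B"
    using b unfolding rapid_iff by blast
  let ?a = "\<lambda>i. weight i ^ k * cmod (a i)"
  have "?a summable_on UNIV"
    using rapid_summable[OF rapid_weight[OF a, of k]] by (simp add: norm_mult norm_power del: of_real_add)
  then have S: "((\<lambda>i. ?a i * B) has_sum infsum ?a UNIV * B) UNIV"
    by (intro has_sum_cmult_left has_sum_infsum)
  have "weight j ^ k * cmod (c j) \<le> infsum ?a UNIV * B" for j
  proof -
    have "norm (of_real (weight j ^ k) * c j) \<le> infsum ?a UNIV * B"
    proof (rule norm_infsum_le[OF has_sum_cmult_right[OF c[of j]] S])
      fix i
      have "norm (of_real (weight j ^ k) * (a i * (u i j * b (j - i)))) = weight j ^ k * (cmod (a i) * cmod (b (j - i)))"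
        by (simp add: norm_mult norm_power u del: of_real_add)
      also have "\<dots> \<le> (weight i * weight (j - i)) ^ k * (cmod (a i) * cmod (b (j - i)))"
        by (intro mult_right_mono power_mono weight_le_mult) auto
      also have "\<dots> = ?a i * (weight (j - i) ^ k * cmod (b (j - i)))"
        by (simp add: power_mult_distrib mult_ac del: fst_diff snd_diff)
      also have "\<dots> \<le> ?a i * B" by (rule mult_left_mono[OF B]) simp
      finally show "norm (of_real (weight j ^ k) * (a i * (u i j * b (j - i)))) \<le> ?a i * B" .
    qed
    then show ?thesis by (simp add: norm_mult norm_power del: of_real_add)
  qed
  then show "\<exists>C. \<forall>i. weight i ^ k * cmod (c i) \<le> C" by blast
qed

section \<open>Series of twisted translations\<close>

definition shift_series :: "(int \<times> int \<Rightarrow> tau_space \<Rightarrow> tau_space) \<Rightarrow> (int \<times> int \<Rightarrow> complex) \<Rightarrow> tau_space \<Rightarrow> tau_space"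
  where "shift_series W a f = (\<Sum>\<^sub>\<infinity>i. a i *\<^sub>C W i f)"

text \<open>A translation of \<open>\<int>\<^sup>2\<close> with unimodular phases; the left and the right multiplications by
  the monomials \<open>U\<^sup>k V\<^sup>l\<close> are two such families with different phases.\<close>

locale twisted_translations =
  fixes W :: "int \<times> int \<Rightarrow> tau_space \<Rightarrow> tau_space" and u :: "int \<times> int \<Rightarrow> int \<times> int \<Rightarrow> complex"
  assumes coord_W: "coord (W i f) j = u i j * coord f (j - i)"
    and cmod_u: "cmod (u i j) = 1"
begin

lemma W_add: "W i (f + g) = W i f + W i g" and W_scaleC: "W i (c *\<^sub>C f) = c *\<^sub>C W i f"
  by (auto intro!: ell2_eqI simp: coord_W algebra_simps)

lemma norm_W: "norm (W i f) = norm f"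
proof -
  have bij: "bij_betw (\<lambda>j. j - i) UNIV UNIV"
    by (rule bij_betw_byWitness[where f' = "\<lambda>j. j + i"]) auto
  have "(norm (W i f))\<^sup>2 = (norm f)\<^sup>2"
    unfolding norm_ell2_sq infsum_reindex_bij_betw[OF bij, of "\<lambda>j. (cmod (coord f j))\<^sup>2", symmetric]
    by (simp add: coord_W norm_mult cmod_u)
  then show ?thesis by simp
qed

lemma bounded_linear_W: "bounded_linear (W i)"
  by (rule bounded_linear_intro[where K = 1]) (simp_all add: W_add W_scaleC scaleR_ell2 norm_W)

context
  fixes a assumes rapid: "rapid a"
begin

lemma shift_series_has_sum: "((\<lambda>i. a i *\<^sub>C W i f) has_sum shift_series W a f) UNIV"
proof -
  have "(\<lambda>i. norm (a i *\<^sub>C W i f)) summable_on UNIV"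
    using summable_on_cmult_left[OF rapid_summable[OF rapid]] by (simp add: norm_scaleC norm_W)
  then show ?thesis
    unfolding shift_series_def by (rule has_sum_infsum[OF abs_summable_summable])
qed

lemma coord_shift_series:
  "((\<lambda>i. a i * (u i j * coord f (j - i))) has_sum coord (shift_series W a f) j) UNIV"
  using has_sum_bounded_linear[OF bounded_linear_coord[of j] shift_series_has_sum[of f]]
  by (simp add: coord_W)

lemma shift_series_scaleC: "shift_series W a (c *\<^sub>C f) = c *\<^sub>C shift_series W a f"
proof (rule has_sum_unique[OF shift_series_has_sum])
  show "((\<lambda>i. a i *\<^sub>C W i (c *\<^sub>C f)) has_sum c *\<^sub>C shift_series W a f) UNIV"
    by (rule has_sum_cong[THEN iffD1, OF _ has_sum_bounded_linear[OF bounded_linear_scaleC[of c]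
            shift_series_has_sum[of f]]]) (auto simp: W_scaleC intro!: ell2_eqI)
qed

lemma bounded_linear_shift_series: "bounded_linear (shift_series W a)"
proof (rule bounded_linear_intro[where K = "infsum (\<lambda>i. cmod (a i)) UNIV"])
  fix f g
  show "shift_series W a (f + g) = shift_series W a f + shift_series W a g"
  proof (rule has_sum_unique[OF shift_series_has_sum])
    show "((\<lambda>i. a i *\<^sub>C W i (f + g)) has_sum shift_series W a f + shift_series W a g) UNIV"
      by (rule has_sum_cong[THEN iffD1, OF _ has_sum_add[OF shift_series_has_sum shift_series_has_sum]])
        (auto simp: W_add algebra_simps intro!: ell2_eqI)
  qed
  show "shift_series W a (r *\<^sub>R f) = r *\<^sub>R shift_series W a f" for r
    by (simp add: scaleR_ell2 shift_series_scaleC)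
  have "norm (shift_series W a f) \<le> infsum (\<lambda>i. cmod (a i)) UNIV * norm f"
    by (rule norm_infsum_le[OF shift_series_has_sum has_sum_cmult_left[OF has_sum_infsum[OF rapid_summable[OF rapid]]]])
      (simp add: norm_scaleC norm_W)
  then show "norm (shift_series W a f) \<le> norm f * infsum (\<lambda>i. cmod (a i)) UNIV"
    by (simp add: mult.commute)
qed

lemma coord_shift_series_ket: "coord (shift_series W a (ket k)) j = a (j - k) * u (j - k) j"
proof (rule has_sum_unique[OF coord_shift_series])
  show "((\<lambda>i. a i * (u i j * coord (ket k) (j - i))) has_sum a (j - k) * u (j - k) j) UNIV"
    by (rule has_sum_finite_neutralI[where B = "{j - k}"]) (auto simp: coord_ket algebra_simps split: if_splits)
qed

lemma shift_series_commute:
  assumes "bounded_linear T" "\<And>c f. T (c *\<^sub>C f) = c *\<^sub>C T f" "\<And>i f. T (W i f) = W i (T f)"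
  shows "T (shift_series W a f) = shift_series W a (T f)"
  using has_sum_unique[OF shift_series_has_sum] has_sum_bounded_linear[OF assms(1) shift_series_has_sum[of f]]
  by (simp add: assms(2,3))

text \<open>The Leibniz rule for the derivation with eigenvalues \<open>d\<close>, where \<open>d\<close> is a character of
  \<open>\<int>\<^sup>2\<close>: on the \<open>i\<close>-th term the eigenvalue at \<open>j\<close> splits as \<open>d i + d (j - i)\<close>.\<close>

lemma shift_series_derivation:
  assumes deg: "\<And>i j. d j = d i + d (j - i)" and rapid': "rapid (\<lambda>i. of_int (d i) * a i)"
    and g: "\<And>j. coord g j = of_int (d j) * coord f j"
  shows "of_int (d j) * coord (shift_series W a f) j =
    coord (shift_series W (\<lambda>i. of_int (d i) * a i) f + shift_series W a g) j"
proof (rule has_sum_unique[OF has_sum_cmult_right[OF coord_shift_series]])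
  let ?a = "\<lambda>i. of_int (d i) * a i"
  have "((\<lambda>i. ?a i *\<^sub>C W i f) has_sum shift_series W ?a f) UNIV"
    unfolding shift_series_def using rapid_summable[OF rapid']
    by (intro has_sum_infsum[OF abs_summable_summable])
      (simp add: norm_scaleC norm_W summable_on_cmult_left)
  from has_sum_bounded_linear[OF bounded_linear_coord[of j] this]
  have "((\<lambda>i. ?a i * (u i j * coord f (j - i))) has_sum coord (shift_series W ?a f) j) UNIV"
    by (simp add: coord_W)
  from has_sum_add[OF this coord_shift_series[of j g]]
  show "((\<lambda>i. of_int (d j) * (a i * (u i j * coord f (j - i)))) has_sum
      coord (shift_series W ?a f + shift_series W a g) j) UNIV"
    unfolding g coord_simps
  proof (rule has_sum_cong[THEN iffD1, rotated])
    fix i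
    show "?a i * (u i j * coord f (j - i)) + a i * (u i j * (of_int (d (j - i)) * coord f (j - i))) =
        of_int (d j) * (a i * (u i j * coord f (j - i)))"
      unfolding deg[of j i] by (simp add: algebra_simps)
  qed
qed

end

lemma shift_series_single: "shift_series W (\<lambda>i. c i * (if i = k then 1 else 0)) f = c k *\<^sub>C W k f"
  unfolding shift_series_def
  by (rule infsumI, rule has_sum_finite_neutralI[where B = "{k}"]) (auto intro!: ell2_eqI)

lemma shift_series_add:
  assumes "rapid a" "rapid b"
  shows "shift_series W (\<lambda>i. a i + b i) f = shift_series W a f + shift_series W b f"
proof (rule has_sum_unique[OF shift_series_has_sum[OF rapid_add[OF assms]]])
  show "((\<lambda>i. (a i + b i) *\<^sub>C W i f) has_sum shift_series W a f + shift_series W b f) UNIV"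
    by (rule has_sum_cong[THEN iffD1, OF _ has_sum_add[OF shift_series_has_sum[OF assms(1)] shift_series_has_sum[OF assms(2)]]])
      (auto simp: algebra_simps intro!: ell2_eqI)
qed

lemma shift_series_scale:
  assumes "rapid a"
  shows "shift_series W (\<lambda>i. c * a i) f = c *\<^sub>C shift_series W a f"
proof (rule has_sum_unique[OF shift_series_has_sum[OF rapid_scale[OF assms]]])
  show "((\<lambda>i. (c * a i) *\<^sub>C W i f) has_sum c *\<^sub>C shift_series W a f) UNIV"
    by (rule has_sum_cong[THEN iffD1, OF _ has_sum_bounded_linear[OF bounded_linear_scaleC[of c] shift_series_has_sum[OF assms]]])
      (auto simp: algebra_simps intro!: ell2_eqI)
qed

end

text \<open>The translations that multiply \<open>U\<^sup>m V\<^sup>n vac\<close> by \<open>U\<^sup>k V\<^sup>l\<close> from the right; the phase comes from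
  \<open>V\<^sup>n U\<^sup>k = exp (- 2 \<pi> i \<theta> k n) U\<^sup>k V\<^sup>n\<close>, with \<open>n - l\<close> for \<open>n\<close> because the index is that of the image.\<close>

lift_definition right_weyl :: "real \<Rightarrow> int \<times> int \<Rightarrow> tau_space \<Rightarrow> tau_space"
  is "\<lambda>\<theta> (k, l) f (m, n). cis (- 2 * pi * \<theta> * of_int (k * (n - l))) * f (m - k, n - l)"
  subgoal for \<theta> i f
    using shift_summable[of f "\<lambda>(m, n). cis (- 2 * pi * \<theta> * of_int (fst i * (n - snd i)))" "fst i" "snd i"]
    by (simp add: case_prod_unfold)
  done

abbreviation left_weyl :: "real \<Rightarrow> int \<times> int \<Rightarrow> tau_space \<Rightarrow> tau_space"
  where "left_weyl \<theta> i \<equiv> weyl \<theta> (fst i) (snd i)"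

lemma coord_right_weyl:
  "coord (right_weyl \<theta> i f) j = cis (- 2 * pi * \<theta> * of_int (fst i * (snd j - snd i))) * coord f (j - i)"
  by transfer (simp add: case_prod_unfold minus_prod_def)

lemma coord_left_weyl:
  "coord (left_weyl \<theta> i f) j = cis (- 2 * pi * \<theta> * of_int (snd i * (fst j - fst i))) * coord f (j - i)"
  using coord_weyl[of \<theta> "fst i" "snd i" f "fst j" "snd j"] by (simp add: minus_prod_def)

interpretation left: twisted_translations "left_weyl \<theta>"
  "\<lambda>i j. cis (- 2 * pi * \<theta> * of_int (snd i * (fst j - fst i)))" for \<theta>
  by standard (simp_all only: coord_left_weyl norm_cis)

interpretation right: twisted_translations "right_weyl \<theta>"
  "\<lambda>i j. cis (- 2 * pi * \<theta> * of_int (fst i * (snd j - snd i)))" for \<theta>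
  by standard (simp_all only: coord_right_weyl norm_cis)

abbreviation lmul :: "real \<Rightarrow> (int \<times> int \<Rightarrow> complex) \<Rightarrow> tau_space \<Rightarrow> tau_space"
  where "lmul \<theta> \<equiv> shift_series (left_weyl \<theta>)"

abbreviation rmul :: "real \<Rightarrow> (int \<times> int \<Rightarrow> complex) \<Rightarrow> tau_space \<Rightarrow> tau_space"
  where "rmul \<theta> \<equiv> shift_series (right_weyl \<theta>)"

lemma left_right_weyl_commute: "left_weyl \<theta> i (right_weyl \<theta> j f) = right_weyl \<theta> j (left_weyl \<theta> i f)"
proof (rule ell2_eqI)
  fix k
  have e: "k - i - j = k - j - i" by simp
  show "coord (left_weyl \<theta> i (right_weyl \<theta> j f)) k = coord (right_weyl \<theta> j (left_weyl \<theta> i f)) k"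
    unfolding coord_left_weyl coord_right_weyl mult.assoc[symmetric] cis_mult e fst_diff snd_diff
    by (simp add: algebra_simps)
qed

lemma right_weyl_vac: "right_weyl \<theta> i vac = ket i"
  by (rule ell2_eqI) (auto simp: coord_right_weyl coord_ket prod_eq_iff)

text \<open>The right translations make the vacuum cyclic, so it separates the operators that commute
  with them.\<close>

lemma eq_if_commute_right_weyl:
  assumes "bounded_linear S" "\<And>c f. S (c *\<^sub>C f) = c *\<^sub>C S f" "\<And>i f. S (right_weyl \<theta> i f) = right_weyl \<theta> i (S f)"
    and "bounded_linear T" "\<And>c f. T (c *\<^sub>C f) = c *\<^sub>C T f" "\<And>i f. T (right_weyl \<theta> i f) = right_weyl \<theta> i (T f)"
    and vac: "S vac = T vac"
  shows "S = T"
proof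
  fix f
  have "S (right_weyl \<theta> i vac) = T (right_weyl \<theta> i vac)" for i
    by (simp only: assms(3,6) vac)
  then have "S (ket i) = T (ket i)" for i
    by (simp only: right_weyl_vac)
  with has_sum_bounded_linear[OF assms(1) ket_has_sum[of f]]
  have "((\<lambda>i. T (coord f i *\<^sub>C ket i)) has_sum S f) UNIV"
    by (simp add: assms)
  then show "S f = T f"
    using has_sum_unique has_sum_bounded_linear[OF assms(4) ket_has_sum[of f]] by blast
qed

lemma coord_lmul_vac: "rapid a \<Longrightarrow> coord (lmul \<theta> a vac) = a"
  by (rule ext) (simp add: left.coord_shift_series_ket flip: zero_prod_def)

lemma lmul_commute_right_weyl:
  assumes "rapid a" shows "lmul \<theta> a (right_weyl \<theta> i f) = right_weyl \<theta> i (lmul \<theta> a f)"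
  using left.shift_series_commute[OF assms right.bounded_linear_W right.W_scaleC]
  by (simp add: left_right_weyl_commute)

text \<open>The coefficients of the product are those of the image of the vacuum, which is a twisted
  convolution; no double series has to be rearranged, as both sides commute with the right
  translations and are thus determined by the vacuum.\<close>

lemma lmul_comp:
  assumes "rapid a" "rapid b"
  obtains c where "rapid c" "lmul \<theta> a \<circ> lmul \<theta> b = lmul \<theta> c"
proof
  let ?c = "coord (lmul \<theta> a (lmul \<theta> b vac))"
  have "((\<lambda>i. a i * (cis (- 2 * pi * \<theta> * of_int (snd i * (fst j - fst i))) * b (j - i))) has_sum ?c j) UNIV" for j
    using left.coord_shift_series[OF assms(1), where j = j and f = "lmul \<theta> b vac"] by (simp only: coord_lmul_vac[OF assms(2)])
  then show c: "rapid ?c"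
    by (rule rapid_twisted_convolution[OF assms, rotated]) (simp only: norm_cis)
  show "lmul \<theta> a \<circ> lmul \<theta> b = lmul \<theta> ?c"
  proof (rule eq_if_commute_right_weyl[where \<theta> = \<theta>])
    show "bounded_linear (lmul \<theta> a \<circ> lmul \<theta> b)"
      unfolding comp_def
      by (intro bounded_linear_compose[of "lmul \<theta> a" "lmul \<theta> b"] left.bounded_linear_shift_series assms)
    show "(lmul \<theta> a \<circ> lmul \<theta> b) vac = lmul \<theta> ?c vac"
      by (rule ell2_eqI) (simp add: coord_lmul_vac[OF c])
  qed (simp_all add: assms c left.bounded_linear_shift_series left.shift_series_scaleC lmul_commute_right_weyl)
qed

lemma smooth_torus_eq: "smooth_torus \<theta> = lmul \<theta> ` Collect rapid"
proof -
  have "(\<forall>f. ((\<lambda>(m, n). a (m, n) *\<^sub>C zpow genU m (zpow (genV \<theta>) n f)) has_sum T f) UNIV) \<longleftrightarrow> T = lmul \<theta> a"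
    if "rapid a" for a T
    using left.shift_series_has_sum[OF that] has_sum_unique
    by (fastforce simp: zpow_UV case_prod_unfold fun_eq_iff)
  then show ?thesis unfolding smooth_torus_def by blast
qed


section \<open>The right action\<close>

lemma bounded_linear_J0: "bounded_linear (J0 \<theta>)"
proof (rule bounded_linear_intro[where K = 1])
  have bij: "bij_betw (\<lambda>(m, n). (- m, - n)) (UNIV :: (int \<times> int) set) UNIV"
    by (rule bij_betw_byWitness[where f' = "\<lambda>(m, n). (- m, - n)"]) auto
  have "(norm (J0 \<theta> f))\<^sup>2 = (norm f)\<^sup>2" for f
    unfolding norm_ell2_sq infsum_reindex_bij_betw[OF bij, of "\<lambda>j. (cmod (coord f j))\<^sup>2", symmetric]
    by (rule infsum_cong) (auto simp: coord_J0 norm_mult)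
  then show "norm (J0 \<theta> f) \<le> norm f * 1" for f by simp
qed (auto intro!: ell2_eqI2 simp: coord_J0 algebra_simps)

lemma J0_J0: "J0 \<theta> (J0 \<theta> f) = f"
  by (rule ell2_eqI2) (simp add: coord_J0 mult.assoc[symmetric] cis_mult cis_cnj)

lemma J0_weyl_J0:
  "J0 \<theta> (c *\<^sub>C weyl \<theta> (- m) (- n) (J0 \<theta> f)) =
    (cnj c * cis (- 2 * pi * \<theta> * of_int (m * n))) *\<^sub>C right_weyl \<theta> (m, n) f"
proof (rule ell2_eqI)
  fix j :: "int \<times> int"
  obtain p q where j: "j = (p, q)" by force
  have phase: "cis A * (c * (cis B * (cis C * x))) = c * cis D * (cis E * x)" if "A + B + C = D + E" for A B C D E c x
  proof -
    have "cis A * (c * (cis B * (cis C * x))) = c * (cis A * cis B * cis C) * x"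
      by (simp only: mult_ac)
    also have "cis A * cis B * cis C = cis D * cis E"
      using that by (simp add: cis_mult)
    finally show ?thesis by (simp only: mult_ac)
  qed
  have e: "- (- p - - m) = p - m" "- (- q - - n) = q - n" by auto
  show "coord (J0 \<theta> (c *\<^sub>C weyl \<theta> (- m) (- n) (J0 \<theta> f))) j =
    coord ((cnj c * cis (- 2 * pi * \<theta> * of_int (m * n))) *\<^sub>C right_weyl \<theta> (m, n) f) j"
    unfolding j coord_J0 coord_simps coord_weyl e complex_cnj_mult complex_cnj_cnj cis_cnj coord_right_weyl
      minus_prod_def fst_conv snd_conv
    by (rule phase) (simp add: algebra_simps)
qed

lemma lmul_series:
  assumes "rapid a"
  shows "((\<lambda>(m, n). a (m, n) *\<^sub>C zpow genU m (zpow (genV \<theta>) n f)) has_sum lmul \<theta> a f) UNIV"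
  using left.shift_series_has_sum[OF assms] by (simp add: zpow_UV case_prod_unfold)

text \<open>Conjugation by the Tomita--Takesaki involution exchanges the left and the right multiplications:
  \<open>J0\<close> is antilinear, which undoes the conjugation of the coefficients in the adjoint.\<close>

lemma rmul_conv_J0:
  assumes "rapid a"
  shows "rmul \<theta> a f = J0 \<theta> (adjoint (lmul \<theta> a) (J0 \<theta> f))"
proof (rule has_sum_unique[OF right.shift_series_has_sum[OF assms]])
  have phase: "cnj (cis x * cnj z) * cis x = z" for x z
  proof -
    have "cnj (cis x * cnj z) * cis x = (cnj (cis x) * cis x) * z" by simp
    then show ?thesis by (simp add: cis_cnj cis_mult)
  qed
  note has_sum_bounded_linear[OF bounded_linear_J0[of \<theta>]
      smooth_torus_adjoint(1)[OF assms lmul_series[OF assms], where g = "J0 \<theta> f"]]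
  then have *: "((\<lambda>i. a (- i) *\<^sub>C right_weyl \<theta> (- i) f) has_sum J0 \<theta> (adjoint (lmul \<theta> a) (J0 \<theta> f))) UNIV"
  proof (rule has_sum_cong[THEN iffD1, rotated])
    fix i :: "int \<times> int"
    obtain m n where i: "i = (m, n)" by force
    show "J0 \<theta> (case i of (m, n) \<Rightarrow> (cis (- 2 * pi * \<theta> * of_int (m * n)) * cnj (a (- m, - n))) *\<^sub>C
        zpow genU m (zpow (genV \<theta>) n (J0 \<theta> f))) = a (- i) *\<^sub>C right_weyl \<theta> (- i) f"
      using J0_weyl_J0[of \<theta> "cis (- 2 * pi * \<theta> * of_int (m * n)) * cnj (a (- m, - n))" "- m" "- n" f]
      unfolding i prod.case zpow_UV minus_minus minus_mult_minus phase by simp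
  qed
  have bij: "bij_betw uminus (UNIV :: (int \<times> int) set) UNIV"
    by (rule bij_betw_byWitness[where f' = uminus]) auto
  show "((\<lambda>i. a i *\<^sub>C right_weyl \<theta> i f) has_sum J0 \<theta> (adjoint (lmul \<theta> a) (J0 \<theta> f))) UNIV"
    using has_sum_reindex_bij_betw[OF bij, THEN iffD1, OF *] .
qed

lemma inner_lmul: "rapid a \<Longrightarrow> inner (lmul \<theta> a f) g = inner f (adjoint (lmul \<theta> a) g)"
  by (rule smooth_torus_adjoint(2)[OF _ lmul_series])

text \<open>Adjoints reverse products, and conjugation by the involution \<open>J0\<close> keeps their order.\<close>

lemma rmul_comp:
  assumes "rapid a" "rapid b" "rapid c" "lmul \<theta> c = lmul \<theta> b \<circ> lmul \<theta> a"
  shows "rmul \<theta> c f = rmul \<theta> a (rmul \<theta> b f)"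
proof -
  have "adjoint (lmul \<theta> c) = adjoint (lmul \<theta> a) \<circ> adjoint (lmul \<theta> b)"
    by (rule adjoint_unique) (simp add: assms inner_lmul)
  then show ?thesis
    by (simp add: rmul_conv_J0 assms(1-3) J0_J0)
qed

lemma torus_eq: "torus \<theta> = {spin (lmul \<theta> a) | a. rapid a}"
  unfolding torus_def smooth_torus_eq by blast

lemma torusE:
  assumes "a \<in> torus \<theta>" obtains \<alpha> where "rapid \<alpha>" "a = spin (lmul \<theta> \<alpha>)"
  using assms unfolding torus_eq by blast

lemma torusI: "rapid \<alpha> \<Longrightarrow> spin (lmul \<theta> \<alpha>) \<in> torus \<theta>"
  unfolding torus_eq by blast

lemma ract_spin:
  assumes "rapid a"
  shows "ract \<theta> h (spin (lmul \<theta> a)) = spin (rmul \<theta> a) h"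
proof -
  have neg: "J0 \<theta> (- f) = - J0 \<theta> f" for f
    using bounded_linear_J0 by (rule linear_neg[OF bounded_linear.linear])
  \<comment> \<open>\<open>Jop\<close> squares to \<open>-1\<close>; this sign cancels the one from the lower left entry of \<open>i sigma2\<close>.\<close>
  have "adjoint (spin (lmul \<theta> a)) = spin (adjoint (lmul \<theta> a))"
    by (rule adjoint_unique) (auto simp: spin_def inner_prod_def inner_lmul[OF assms])
  moreover have "inv (Jop \<theta>) = (\<lambda>h. - Jop \<theta> h)"
    by (rule inv_equality) (auto simp: Jop_def neg J0_J0)
  moreover have "adjoint (lmul \<theta> a) (- f) = - adjoint (lmul \<theta> a) f" for f
  proof -
    have "inner g (adjoint (lmul \<theta> a) (- f) + adjoint (lmul \<theta> a) f) = 0" for g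
      by (simp add: inner_add_right flip: inner_lmul[OF assms])
    then have "adjoint (lmul \<theta> a) (- f) + adjoint (lmul \<theta> a) f = 0"
      by (rule inner_eq_zero_iff[THEN iffD1])
    then show ?thesis by (rule eq_neg_iff_add_eq_0[THEN iffD2])
  qed
  ultimately show ?thesis
    by (cases h) (simp add: ract_def Jop_def spin_def rmul_conv_J0[OF assms] neg)
qed

section \<open>The torus and its derivations on spinors\<close>

text \<open>The graph of the diagonal operator with eigenvalue \<open>d j\<close> at the basis vector \<open>j\<close>, so that
  \<open>delta1\<close> and \<open>delta2\<close> are instances of one construction.\<close>

definition grading :: "(int \<times> int \<Rightarrow> int) \<Rightarrow> graph"
  where "grading d = spin_graph {(f, g). \<forall>j. coord g j = of_int (d j) * coord f j}"

lemma grading_iff: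
  "(v, w) \<in> grading d \<longleftrightarrow> (\<forall>j. coord (fst w) j = of_int (d j) * coord (fst v) j) \<and>
    (\<forall>j. coord (snd w) j = of_int (d j) * coord (snd v) j)"
  by (auto simp: grading_def spin_graph_def split: prod.splits)

lemma delta_grading: "delta1 = grading fst" "delta2 = grading snd"
  by (simp_all add: delta1_def delta2_def grading_def split_paired_All)

lemma (in twisted_translations) grading_Leibniz:
  assumes a: "rapid a" "rapid (\<lambda>i. of_int (d i) * a i)" and d: "\<And>i j. d j = d i + d (j - i)"
    and vw: "(v, w) \<in> grading d"
  shows "(spin (shift_series W a) v, spin (shift_series W (\<lambda>i. of_int (d i) * a i)) v + spin (shift_series W a) w)
    \<in> grading d"
  using vw shift_series_derivation[OF a(1) d a(2), symmetric]
  by (auto simp: grading_iff spin_def split_beta)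

lemma commutator_delta:
  assumes "rapid a"
  shows "commutator delta1 (spin (lmul \<theta> a)) = spin (lmul \<theta> (\<lambda>i. of_int (fst i) * a i))"
    and "commutator delta2 (spin (lmul \<theta> a)) = spin (lmul \<theta> (\<lambda>i. of_int (snd i) * a i))"
proof -
  show "commutator delta1 (spin (lmul \<theta> a)) = spin (lmul \<theta> (\<lambda>i. of_int (fst i) * a i))"
    by (rule commutator_eqI[OF single_valued_delta(1) dense_Domain_delta(1)
          bounded_linear_spin[OF left.bounded_linear_shift_series[OF rapid_fst[OF assms]]]])
      (auto simp: delta_grading intro!: left.grading_Leibniz assms rapid_fst)
  show "commutator delta2 (spin (lmul \<theta> a)) = spin (lmul \<theta> (\<lambda>i. of_int (snd i) * a i))"
    by (rule commutator_eqI[OF single_valued_delta(2) dense_Domain_delta(2)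
          bounded_linear_spin[OF left.bounded_linear_shift_series[OF rapid_snd[OF assms]]]])
      (auto simp: delta_grading intro!: left.grading_Leibniz assms rapid_snd)
qed

lemma torus_bounded_linear: "a \<in> torus \<theta> \<Longrightarrow> bounded_linear a"
  by (auto elim!: torusE intro!: bounded_linear_spin left.bounded_linear_shift_series)

lemma torus_commutator: 
  assumes "a \<in> torus \<theta>"
  shows "commutator delta1 a \<in> torus \<theta>" "commutator delta2 a \<in> torus \<theta>"
  using assms by (auto elim!: torusE intro!: torusI rapid_fst rapid_snd simp: commutator_delta)

lemma torus_Leibniz:
  assumes "a \<in> torus \<theta>"
  shows "(v, w) \<in> delta1 \<Longrightarrow> (a v, commutator delta1 a v + a w) \<in> delta1"
    and "(v, w) \<in> delta2 \<Longrightarrow> (a v, commutator delta2 a v + a w) \<in> delta2"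
  using assms unfolding delta_grading
  by (auto elim!: torusE simp: commutator_delta[unfolded delta_grading]
      intro!: left.grading_Leibniz rapid_fst rapid_snd)

lemma ract_Leibniz:
  assumes "a \<in> torus \<theta>"
  shows "(v, w) \<in> delta1 \<Longrightarrow> (ract \<theta> v a, ract \<theta> v (commutator delta1 a) + ract \<theta> w a) \<in> delta1"
    and "(v, w) \<in> delta2 \<Longrightarrow> (ract \<theta> v a, ract \<theta> v (commutator delta2 a) + ract \<theta> w a) \<in> delta2"
  using assms unfolding delta_grading
  by (auto elim!: torusE simp: commutator_delta[unfolded delta_grading] ract_spin rapid_fst rapid_snd
      intro!: right.grading_Leibniz)

lemma torus_comp: "a \<in> torus \<theta> \<Longrightarrow> b \<in> torus \<theta> \<Longrightarrow> (\<lambda>v. a (b v)) \<in> torus \<theta>"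
proof (elim torusE)
  fix \<alpha> \<beta> assume *: "rapid \<alpha>" "a = spin (lmul \<theta> \<alpha>)" "rapid \<beta>" "b = spin (lmul \<theta> \<beta>)"
  obtain \<gamma> where "rapid \<gamma>" "lmul \<theta> \<alpha> \<circ> lmul \<theta> \<beta> = lmul \<theta> \<gamma>"
    using lmul_comp[OF *(1,3)] .
  moreover from this(2) have "(\<lambda>v. a (b v)) = spin (lmul \<theta> \<gamma>)"
    by (auto simp: *(2,4) spin_def fun_eq_iff)
  ultimately show ?thesis by (simp add: torusI)
qed

lemma ract_comp:
  assumes "a \<in> torus \<theta>" "b \<in> torus \<theta>"
  shows "ract \<theta> h (\<lambda>v. b (a v)) = ract \<theta> (ract \<theta> h b) a"
proof -
  obtain \<alpha> \<beta> where *: "rapid \<alpha>" "a = spin (lmul \<theta> \<alpha>)" "rapid \<beta>" "b = spin (lmul \<theta> \<beta>)"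
    using assms by (auto elim!: torusE)
  obtain \<gamma> where \<gamma>: "rapid \<gamma>" "lmul \<theta> \<beta> \<circ> lmul \<theta> \<alpha> = lmul \<theta> \<gamma>"
    using lmul_comp[OF *(3,1)] .
  then have ba: "(\<lambda>v. b (a v)) = spin (lmul \<theta> \<gamma>)"
    by (auto simp: *(2,4) spin_def fun_eq_iff)
  show ?thesis
    unfolding ba using rmul_comp[OF *(1,3) \<gamma>(1) \<gamma>(2)[symmetric]]
    by (cases h) (simp add: * \<gamma>(1) ract_spin, simp add: spin_def)
qed

lemma torus_add: "a \<in> torus \<theta> \<Longrightarrow> b \<in> torus \<theta> \<Longrightarrow> (\<lambda>v. a v + b v) \<in> torus \<theta>"
  and ract_add: "a \<in> torus \<theta> \<Longrightarrow> b \<in> torus \<theta> \<Longrightarrow> ract \<theta> h (\<lambda>v. a v + b v) = ract \<theta> h a + ract \<theta> h b"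
proof -
  assume "a \<in> torus \<theta>" "b \<in> torus \<theta>"
  then obtain \<alpha> \<beta> where *: "rapid \<alpha>" "a = spin (lmul \<theta> \<alpha>)" "rapid \<beta>" "b = spin (lmul \<theta> \<beta>)"
    by (auto elim!: torusE)
  have ab: "(\<lambda>v. a v + b v) = spin (lmul \<theta> (\<lambda>i. \<alpha> i + \<beta> i))"
    by (auto simp: * spin_def left.shift_series_add)
  show "(\<lambda>v. a v + b v) \<in> torus \<theta>"
    unfolding ab using *(1,3) by (intro torusI rapid_add)
  show "ract \<theta> h (\<lambda>v. a v + b v) = ract \<theta> h a + ract \<theta> h b"
    unfolding ab using * by (cases h) (simp add: ract_spin rapid_add, simp add: spin_def right.shift_series_add)
qed

lemma torus_scaleR: "a \<in> torus \<theta> \<Longrightarrow> (\<lambda>v. r *\<^sub>R a v) \<in> torus \<theta>"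
  and ract_scaleR: "a \<in> torus \<theta> \<Longrightarrow> ract \<theta> h (\<lambda>v. r *\<^sub>R a v) = r *\<^sub>R ract \<theta> h a"
proof -
  assume "a \<in> torus \<theta>"
  then obtain \<alpha> where *: "rapid \<alpha>" "a = spin (lmul \<theta> \<alpha>)" by (rule torusE)
  have ra: "(\<lambda>v. r *\<^sub>R a v) = spin (lmul \<theta> (\<lambda>i. of_real r * \<alpha> i))"
    by (auto simp: * spin_def left.shift_series_scale scaleR_ell2)
  show "(\<lambda>v. r *\<^sub>R a v) \<in> torus \<theta>"
    unfolding ra using *(1) by (intro torusI rapid_scale)
  show "ract \<theta> h (\<lambda>v. r *\<^sub>R a v) = r *\<^sub>R ract \<theta> h a"
    unfolding ra using * by (cases h) (simp add: ract_spin rapid_scale, simp add: spin_def right.shift_series_scale scaleR_ell2)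
qed

lemma rapid_delta: "rapid (\<lambda>i. if i = k then 1 else 0)"
  by (rule rapid_finite[of "{k}"]) auto

lemma torus_weyl: "spin (left_weyl \<theta> k) \<in> torus \<theta>"
  and commutator_weyl: "commutator delta1 (spin (left_weyl \<theta> k)) = (\<lambda>v. of_int (fst k) *\<^sub>R spin (left_weyl \<theta> k) v)"
    "commutator delta2 (spin (left_weyl \<theta> k)) = (\<lambda>v. of_int (snd k) *\<^sub>R spin (left_weyl \<theta> k) v)"
proof -
  have 1: "left_weyl \<theta> k = lmul \<theta> (\<lambda>i. if i = k then 1 else 0)"
    using left.shift_series_single[of \<theta> "\<lambda>_. 1" k] by (auto intro!: ell2_eqI)
  show "spin (left_weyl \<theta> k) \<in> torus \<theta>"
    unfolding 1 by (rule torusI[OF rapid_delta])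
  show "commutator delta1 (spin (left_weyl \<theta> k)) = (\<lambda>v. of_int (fst k) *\<^sub>R spin (left_weyl \<theta> k) v)"
    unfolding 1 commutator_delta(1)[OF rapid_delta] left.shift_series_single unfolding 1[symmetric]
    by (auto simp: spin_def scaleR_ell2)
  show "commutator delta2 (spin (left_weyl \<theta> k)) = (\<lambda>v. of_int (snd k) *\<^sub>R spin (left_weyl \<theta> k) v)"
    unfolding 1 commutator_delta(2)[OF rapid_delta] left.shift_series_single unfolding 1[symmetric]
    by (auto simp: spin_def scaleR_ell2)
qed

lemma ract_weyl: "ract \<theta> h (spin (left_weyl \<theta> k)) = spin (right_weyl \<theta> k) h"
proof -
  have "left_weyl \<theta> k = lmul \<theta> (\<lambda>i. if i = k then 1 else 0)"
    "right_weyl \<theta> k = rmul \<theta> (\<lambda>i. if i = k then 1 else 0)"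
    using left.shift_series_single[of \<theta> "\<lambda>_. 1" k] right.shift_series_single[of \<theta> "\<lambda>_. 1" k]
    by (auto intro!: ell2_eqI)
  then show ?thesis using ract_spin[OF rapid_delta] by simp
qed

lemma spin_left_weyl_0: "spin (left_weyl \<theta> 0) = (\<lambda>v. v)"
  by (auto simp: spin_def weyl_0)

lemma torus_id: "(\<lambda>v. v) \<in> torus \<theta>"
  using torus_weyl[of \<theta> 0] by (simp only: spin_left_weyl_0)

lemma torus_zero: "(\<lambda>v. 0) \<in> torus \<theta>" and ract_zero: "ract \<theta> h (\<lambda>v. 0) = 0"
  using torus_scaleR[OF torus_id, of 0] ract_scaleR[OF torus_id, of \<theta> h 0] by simp_all

lemma torus_sum:
  assumes "\<And>i. i \<in> I \<Longrightarrow> a i \<in> torus \<theta>"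
  shows "(\<lambda>v. \<Sum>i\<in>I. a i v) \<in> torus \<theta>"
    and ract_sum: "ract \<theta> h (\<lambda>v. \<Sum>i\<in>I. a i v) = (\<Sum>i\<in>I. ract \<theta> h (a i))"
proof -
  have "(\<lambda>v. \<Sum>i\<in>I. a i v) \<in> torus \<theta> \<and> ract \<theta> h (\<lambda>v. \<Sum>i\<in>I. a i v) = (\<Sum>i\<in>I. ract \<theta> h (a i))"
    using assms
    by (induction I rule: infinite_finite_induct) (simp_all add: torus_zero ract_zero torus_add ract_add)
  then show "(\<lambda>v. \<Sum>i\<in>I. a i v) \<in> torus \<theta>" "ract \<theta> h (\<lambda>v. \<Sum>i\<in>I. a i v) = (\<Sum>i\<in>I. ract \<theta> h (a i))"
    by blast+
qed

lemma ract_bounded_linear: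
  assumes "a \<in> torus \<theta>" shows "bounded_linear (\<lambda>h. ract \<theta> h a)"
proof -
  obtain \<alpha> where a: "rapid \<alpha>" "a = spin (lmul \<theta> \<alpha>)" using assms by (rule torusE)
  show ?thesis unfolding a(2) ract_spin[OF a(1)]
    using bounded_linear_spin[OF right.bounded_linear_shift_series[OF a(1)]] .
qed

lemma sigma_commute_spin:
  assumes "bounded_linear T" "\<And>c f. T (c *\<^sub>C f) = c *\<^sub>C T f"
  shows "spin T (sigma1 v) = sigma1 (spin T v)" "spin T (sigma2 v) = sigma2 (spin T v)"
  using assms(2)[of "- \<i>"] assms(2)
  by (auto simp: spin_def sigma1_def sigma2_def split_beta linear_neg[OF bounded_linear.linear[OF assms(1)]])

lemma torus_sigma:
  assumes "a \<in> torus \<theta>"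
  shows "a (sigma1 v) = sigma1 (a v)" "a (sigma2 v) = sigma2 (a v)"
  using assms by (auto elim!: torusE intro!: sigma_commute_spin left.bounded_linear_shift_series left.shift_series_scaleC)

lemma ract_sigma1:
  assumes "a \<in> torus \<theta>" shows "ract \<theta> (sigma1 v) a = sigma1 (ract \<theta> v a)"
  using assms by (auto elim!: torusE simp: ract_spin intro!: sigma_commute_spin right.bounded_linear_shift_series right.shift_series_scaleC)

lemma bounded_linear_sigma: "bounded_linear sigma1" "bounded_linear sigma2"
proof -
  have s1: "sigma1 = (\<lambda>v. (snd v, fst v))" by (auto simp: sigma1_def)
  show "bounded_linear sigma1"
    by (subst s1) (intro bounded_linear_Pair bounded_linear_fst bounded_linear_snd)
  have s2: "sigma2 = (\<lambda>v. ((- \<i>) *\<^sub>C snd v, \<i> *\<^sub>C fst v))" by (auto simp: sigma2_def)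
  show "bounded_linear sigma2"
    by (subst s2) (intro bounded_linear_Pair bounded_linear_compose[OF bounded_linear_scaleC]
        bounded_linear_fst bounded_linear_snd)
qed

lemma sigma_sigma: "sigma1 (sigma1 v) = v" "sigma2 (sigma2 v) = v"
  by (auto simp: sigma1_def sigma2_def split_beta intro!: prod_eqI ell2_eqI)

text \<open>On \<open>(x, x)\<close> the two spinor components of \<open>sigma1 a + sigma2 b\<close> are \<open>a x - i (b x)\<close> and
  \<open>a x + i (b x)\<close>, which determine \<open>a x\<close> and \<open>b x\<close>.\<close>

lemma sigma_forms_eqD:
  assumes "a \<in> torus \<theta>" "b \<in> torus \<theta>" "a' \<in> torus \<theta>" "b' \<in> torus \<theta>"
    and eq: "\<And>v. sigma1 (a v) + sigma2 (b v) = sigma1 (a' v) + sigma2 (b' v)"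
  shows "a = a'" "b = b'"
proof -
  obtain A B A' B' where *: "a = spin A" "b = spin B" "a' = spin A'" "b' = spin B'"
    using assms unfolding torus_def by blast
  have "A x = A' x \<and> B x = B' x" for x
  proof -
    have "coord (A x) j = coord (A' x) j \<and> coord (B x) j = coord (B' x) j" for j
    proof -
      have "coord (A x) j - \<i> * coord (B x) j = coord (A' x) j - \<i> * coord (B' x) j"
        "coord (A x) j + \<i> * coord (B x) j = coord (A' x) j + \<i> * coord (B' x) j"
        using eq[of "(x, x)", THEN arg_cong[where f = "\<lambda>v. coord (fst v) j"]]
          eq[of "(x, x)", THEN arg_cong[where f = "\<lambda>v. coord (snd v) j"]]
        by (simp_all add: * spin_def sigma1_def sigma2_def)
      moreover from this have "coord (A x) j = coord (A' x) j" by algebra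
      ultimately show ?thesis by simp
    qed
    then show ?thesis by (auto intro!: ell2_eqI)
  qed
  then show "a = a'" "b = b'" unfolding * by metis+
qed


section \<open>Commutators with the Dirac operator\<close>

lemma sigma_linear:
  "sigma1 (v + w) = sigma1 v + sigma1 w" "sigma2 (v + w) = sigma2 v + sigma2 w"
  "sigma1 (v - w) = sigma1 v - sigma1 w" "sigma1 (r *\<^sub>R v) = r *\<^sub>R sigma1 v" "sigma1 0 = 0" "sigma2 0 = 0"
  using bounded_linear_sigma[THEN bounded_linear.linear]
  by (auto simp: linear_add linear_diff linear_scale linear_0)

lemma torus_linear:
  assumes "a \<in> torus \<theta>"
  shows "a (v + w) = a v + a w" "a (v - w) = a v - a w" "a 0 = 0" "a (\<Sum>i\<in>I. f i) = (\<Sum>i\<in>I. a (f i))"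
  using torus_bounded_linear[OF assms, THEN bounded_linear.linear]
  by (auto simp: linear_add linear_diff linear_0 linear_sum)

lemma ract_linear:
  assumes "a \<in> torus \<theta>"
  shows "ract \<theta> (v + w) a = ract \<theta> v a + ract \<theta> w a" "ract \<theta> (r *\<^sub>R v) a = r *\<^sub>R ract \<theta> v a" "ract \<theta> 0 a = 0"
proof -
  have l: "linear (\<lambda>h. ract \<theta> h a)"
    using ract_bounded_linear[OF assms] by (rule bounded_linear.linear)
  show "ract \<theta> (v + w) a = ract \<theta> v a + ract \<theta> w a" "ract \<theta> (r *\<^sub>R v) a = r *\<^sub>R ract \<theta> v a" "ract \<theta> 0 a = 0"
    using linear_add[OF l] linear_scale[OF l] linear_0[OF l] by auto
qed

lemma subspace_delta: "subspace delta1" "subspace delta2"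
  unfolding delta_grading by (auto simp: subspace_def grading_iff zero_prod_def algebra_simps)

lemma delta2_sigma1: "(sigma1 v, sigma1 w) \<in> delta2 \<longleftrightarrow> (v, w) \<in> delta2"
  and delta2_sigma2: "(v, w) \<in> delta2 \<Longrightarrow> (sigma2 v, sigma2 w) \<in> delta2"
  by (auto simp: delta_grading grading_iff sigma1_def sigma2_def split_beta)

lemma single_valued_dirac: "single_valued dirac"
proof (rule single_valuedI)
  fix v w w' assume "(v, w) \<in> dirac" "(v, w') \<in> dirac"
  then show "w = w'"
    unfolding dirac_def using single_valued_delta[THEN single_valuedD] by blast
qed

lemma dense_Domain_dirac: "closure (Domain dirac) = UNIV"
proof -
  have "Domain delta1 \<inter> Domain delta2 \<subseteq> Domain dirac"
    unfolding dirac_def by blast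
  then show ?thesis using dense_delta closure_mono by blast
qed

lemma diracI: "(v, x) \<in> delta1 \<Longrightarrow> (v, y) \<in> delta2 \<Longrightarrow> w = sigma1 x + sigma2 y \<Longrightarrow> (v, w) \<in> dirac"
  unfolding dirac_def by blast

lemma diracE:
  assumes "(v, w) \<in> dirac" obtains x y where "(v, x) \<in> delta1" "(v, y) \<in> delta2" "w = sigma1 x + sigma2 y"
  using assms unfolding dirac_def by blast

lemma commutator_dirac:
  assumes a: "a \<in> torus \<theta>"
  shows "commutator dirac a = (\<lambda>v. sigma1 (commutator delta1 a v) + sigma2 (commutator delta2 a v))"
proof (rule commutator_eqI[OF single_valued_dirac dense_Domain_dirac])
  show "bounded_linear (\<lambda>v. sigma1 (commutator delta1 a v) + sigma2 (commutator delta2 a v))"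
    by (intro bounded_linear_add bounded_linear_compose[OF bounded_linear_sigma(1)]
        bounded_linear_compose[OF bounded_linear_sigma(2)] torus_bounded_linear[of _ \<theta>] torus_commutator a)
  fix v w assume "(v, w) \<in> dirac"
  then obtain x y where xy: "(v, x) \<in> delta1" "(v, y) \<in> delta2" "w = sigma1 x + sigma2 y"
    by (rule diracE)
  show "(a v, sigma1 (commutator delta1 a v) + sigma2 (commutator delta2 a v) + a w) \<in> dirac"
    using torus_Leibniz(1)[OF a xy(1)] torus_Leibniz(2)[OF a xy(2)]
    by (rule diracI) (simp add: xy(3) torus_linear[OF a] torus_sigma[OF a] sigma_linear)
qed

lemma base_iff: "b \<in> base \<theta> \<longleftrightarrow> b \<in> torus \<theta> \<and> commutator delta2 b = (\<lambda>v. 0)"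
  by (simp add: torus_deg_def)

lemma commutator_dirac_base: "b \<in> base \<theta> \<Longrightarrow> commutator dirac b = (\<lambda>v. sigma1 (commutator delta1 b v))"
  using commutator_dirac[of b \<theta>] by (simp add: base_iff sigma_linear)

lemma ract_sigma2:
  assumes "a \<in> torus \<theta>" shows "ract \<theta> (sigma2 v) a = sigma2 (ract \<theta> v a)"
  using assms by (auto elim!: torusE simp: ract_spin
      intro!: sigma_commute_spin right.bounded_linear_shift_series right.shift_series_scaleC)

text \<open>Right multiplication by an element of degree zero commutes with \<open>delta2\<close>, so only \<open>sigma1 delta1\<close>
  contributes.\<close>

lemma commutator_dirac_ract:
  assumes b: "b \<in> base \<theta>"
  shows "commutator dirac (\<lambda>x. ract \<theta> x b) = (\<lambda>v. sigma1 (ract \<theta> v (commutator delta1 b)))"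
proof (rule commutator_eqI[OF single_valued_dirac dense_Domain_dirac])
  have b': "b \<in> torus \<theta>" "commutator delta2 b = (\<lambda>v. 0)" using b by (auto simp: base_iff)
  show "bounded_linear (\<lambda>v. sigma1 (ract \<theta> v (commutator delta1 b)))"
    by (intro bounded_linear_compose[OF bounded_linear_sigma(1)] ract_bounded_linear torus_commutator b')
  fix v w assume "(v, w) \<in> dirac"
  then obtain x y where xy: "(v, x) \<in> delta1" "(v, y) \<in> delta2" "w = sigma1 x + sigma2 y"
    by (rule diracE)
  show "(ract \<theta> v b, sigma1 (ract \<theta> v (commutator delta1 b)) + ract \<theta> w b) \<in> dirac"
    using ract_Leibniz(1)[OF b'(1) xy(1)] ract_Leibniz(2)[OF b'(1) xy(2)]
    by (rule diracI)
      (simp add: xy(3) ract_linear[OF b'(1)] ract_sigma1[OF b'(1)] ract_sigma2[OF b'(1)] sigma_linear b'(2) ract_zero)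
qed

section \<open>One-forms and their right action\<close>

lemma base_weyl: "spin (weyl \<theta> m 0) \<in> base \<theta>"
  using torus_weyl[of \<theta> "(m, 0)"] commutator_weyl(2)[of \<theta> "(m, 0)"] by (simp add: base_iff)

lemma spin_weyl_inverse: "spin (weyl \<theta> (- 1) 0) (spin (weyl \<theta> 1 0) v) = v" "spin (weyl \<theta> 0 (- 1)) (spin (weyl \<theta> 0 1) v) = v"
  by (simp_all add: spin_def split_beta weyl_U weyl_V weyl_0)

lemma sigma1_eq_weyl: "sigma1 v = spin (weyl \<theta> (- 1) 0) (commutator dirac (spin (weyl \<theta> 1 0)) v)"
  using commutator_dirac_base[OF base_weyl[of \<theta> 1]]
    torus_sigma(1)[OF torus_weyl[of \<theta> "(- 1, 0)"]] commutator_weyl(1)[of \<theta> "(1, 0)"]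
  by (simp add: spin_weyl_inverse)

lemma sigma2_eq_weyl: "sigma2 v = spin (weyl \<theta> 0 (- 1)) (commutator dirac (spin (weyl \<theta> 0 1)) v)"
  using commutator_dirac[OF torus_weyl[of \<theta> "(0, 1)"]]
    torus_sigma(2)[OF torus_weyl[of \<theta> "(0, - 1)"]] commutator_weyl[of \<theta> "(0, 1)"]
  by (simp add: spin_weyl_inverse sigma_linear)

lemma one_formsI:
  assumes "p \<in> X" "q \<in> X" shows "(\<lambda>v. p (commutator dirac q v)) \<in> one_forms X"
  unfolding one_forms_def
  by (rule CollectI, intro exI[of _ "1::nat"] exI[of _ "\<lambda>_. p"] exI[of _ "\<lambda>_. q"]) (simp add: assms)

lemma sigma1_one_form: "sigma1 \<in> one_forms (base \<theta>)"
  using one_formsI[OF base_weyl[of \<theta> "- 1"] base_weyl[of \<theta> 1]] by (simp only: sigma1_eq_weyl[symmetric])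

lemma sigma2_one_form: "sigma2 \<in> one_forms (torus \<theta>)"
  using one_formsI[OF torus_weyl[of \<theta> "(0, - 1)"] torus_weyl[of \<theta> "(0, 1)"]]
  by (simp only: sigma2_eq_weyl[symmetric] fst_conv snd_conv)

lemma ract_id: "ract \<theta> h (\<lambda>v. v) = h"
proof -
  have "right_weyl \<theta> 0 f = f" for f
    by (rule ell2_eqI) (simp add: coord_right_weyl)
  then show ?thesis
    using ract_weyl[of \<theta> h 0] unfolding spin_left_weyl_0 by (simp add: spin_def)
qed

lemma one_form_sum:
  assumes "\<And>i. i \<in> I \<Longrightarrow> p i \<in> torus \<theta>" "\<And>i. i \<in> I \<Longrightarrow> q i \<in> torus \<theta>"
  shows "(\<Sum>i\<in>I. p i (commutator dirac (q i) v)) =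
    sigma1 (\<Sum>i\<in>I. p i (commutator delta1 (q i) v)) + sigma2 (\<Sum>i\<in>I. p i (commutator delta2 (q i) v))"
proof -
  have "p i (commutator dirac (q i) v) = sigma1 (p i (commutator delta1 (q i) v)) + sigma2 (p i (commutator delta2 (q i) v))"
    if "i \<in> I" for i
    using assms(1)[OF that] assms(2)[OF that] by (simp add: commutator_dirac torus_linear torus_sigma)
  then show ?thesis
    by (simp add: sum.distrib linear_sum[OF bounded_linear.linear] bounded_linear_sigma)
qed

lemma torus_form_coefficient:
  assumes "\<And>i. i \<in> I \<Longrightarrow> p i \<in> torus \<theta>" "\<And>i. i \<in> I \<Longrightarrow> q i \<in> torus \<theta>"
  shows "(\<lambda>v. \<Sum>i\<in>I. p i (commutator delta1 (q i) v)) \<in> torus \<theta>"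
    and "(\<lambda>v. \<Sum>i\<in>I. p i (commutator delta2 (q i) v)) \<in> torus \<theta>"
  by (rule torus_sum(1), rule torus_comp[OF assms(1) torus_commutator(1)[OF assms(2)]], assumption+,
      rule torus_sum(1), rule torus_comp[OF assms(1) torus_commutator(2)[OF assms(2)]])

text \<open>The value does not depend on the presentation of the form: \<open>b' [D, b] a\<close> equals
  \<open>sigma1 (b' (D\<^sub>1 b) a)\<close> and sends \<open>h\<close> to \<open>sigma1 (h (b' (D\<^sub>1 b) a))\<close>, so the sum over a presentation of
  \<open>sigma1 c\<close> recovers \<open>sigma1 (h c)\<close>. A presentation exists, since \<open>sigma1 = U\<^sup>-\<^sup>1 [D, U]\<close>.\<close>

lemma ract_form_sigma1:
  assumes c: "c \<in> torus \<theta>"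
  shows "ract_form \<theta> h (\<lambda>v. sigma1 (c v)) = sigma1 (ract \<theta> h c)"
  unfolding ract_form_def
proof (rule the_equality)
  let ?U = "spin (weyl \<theta> 1 0)" and ?U' = "spin (weyl \<theta> (- 1) 0)"
  have U: "?U \<in> base \<theta>" "?U' \<in> base \<theta>" "commutator delta1 ?U = ?U"
    using base_weyl commutator_weyl(1)[of \<theta> "(1, 0)"] by auto
  then have U': "?U \<in> torus \<theta>" "?U' \<in> torus \<theta>" by (auto simp: base_iff)
  have "ract \<theta> (ract \<theta> h ?U') ?U = h"
    using ract_comp[OF U', of h] by (simp add: spin_weyl_inverse ract_id)
  then have act: "sigma1 (ract \<theta> h c) = ract \<theta> (commutator dirac (\<lambda>x. ract \<theta> x ?U) (ract \<theta> h ?U')) c"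
    using U ract_sigma1[OF c] by (simp add: commutator_dirac_ract)
  have form: "(\<lambda>v. sigma1 (c v)) = (\<lambda>v. ?U' (commutator dirac ?U (c v)))"
    using sigma1_eq_weyl by blast
  have one: "(\<Sum>i<1. f i) = f 0" for f :: "nat \<Rightarrow> spinor" by simp
  show "\<exists>(n::nat) b' b a. (\<forall>i<n. b' i \<in> base \<theta> \<and> b i \<in> base \<theta> \<and> a i \<in> torus \<theta>) \<and>
    (\<lambda>v. sigma1 (c v)) = (\<lambda>v. \<Sum>i<n. b' i (commutator dirac (b i) (a i v))) \<and>
    sigma1 (ract \<theta> h c) = (\<Sum>i<n. ract \<theta> (commutator dirac (\<lambda>x. ract \<theta> x (b i)) (ract \<theta> h (b' i))) (a i))"
    by (rule exI[of _ 1], rule exI[of _ "\<lambda>_. ?U'"], rule exI[of _ "\<lambda>_. ?U"], rule exI[of _ "\<lambda>_. c"],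
        unfold one, intro conjI allI impI U(1,2) c act form)
next
  fix w assume "\<exists>(n::nat) b' b a. (\<forall>i<n. b' i \<in> base \<theta> \<and> b i \<in> base \<theta> \<and> a i \<in> torus \<theta>) \<and>
    (\<lambda>v. sigma1 (c v)) = (\<lambda>v. \<Sum>i<n. b' i (commutator dirac (b i) (a i v))) \<and>
    w = (\<Sum>i<n. ract \<theta> (commutator dirac (\<lambda>x. ract \<theta> x (b i)) (ract \<theta> h (b' i))) (a i))"
  then obtain n :: nat and b' b a where mem_all: "\<forall>i<n. b' i \<in> base \<theta> \<and> b i \<in> base \<theta> \<and> a i \<in> torus \<theta>"
    and c_eq: "(\<lambda>v. sigma1 (c v)) = (\<lambda>v. \<Sum>i<n. b' i (commutator dirac (b i) (a i v)))"
    and w: "w = (\<Sum>i<n. ract \<theta> (commutator dirac (\<lambda>x. ract \<theta> x (b i)) (ract \<theta> h (b' i))) (a i))"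
    by (elim exE conjE) (rule that)
  have mem: "b' i \<in> base \<theta>" "b i \<in> base \<theta>" "a i \<in> torus \<theta>" if "i < n" for i
    using mem_all that by auto
  define e where "e i = (\<lambda>v. b' i (commutator delta1 (b i) (a i v)))" for i
  have mem': "b' i \<in> torus \<theta>" "commutator delta1 (b i) \<in> torus \<theta>" if "i < n" for i
    using mem(1,2)[OF that] by (auto simp: base_iff torus_commutator)
  have e: "e i \<in> torus \<theta>" if "i < n" for i
    unfolding e_def by (rule torus_comp[OF mem'(1)[OF that] torus_comp[OF mem'(2)[OF that] mem(3)[OF that]]])
  have "c = (\<lambda>v. \<Sum>i<n. e i v)"
  proof
    fix v
    have "sigma1 (c v) = (\<Sum>i<n. b' i (commutator dirac (b i) (a i v)))"
      using c_eq by (rule fun_cong)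
    also have "\<dots> = (\<Sum>i<n. sigma1 (e i v))"
      using commutator_dirac_base[OF mem(2)] torus_sigma(1)[OF mem'(1)] by (intro sum.cong) (simp_all add: e_def)
    finally have "sigma1 (c v) = sigma1 (\<Sum>i<n. e i v)"
      by (simp add: linear_sum[OF bounded_linear.linear] bounded_linear_sigma)
    then show "c v = (\<Sum>i<n. e i v)" by (metis sigma_sigma(1))
  qed
  then have "ract \<theta> h c = (\<Sum>i<n. ract \<theta> h (e i))"
    using ract_sum[of "{..<n}" e] e by simp
  moreover have "ract \<theta> h (e i) = ract \<theta> (ract \<theta> (ract \<theta> h (b' i)) (commutator delta1 (b i))) (a i)" if "i < n" for i
    unfolding e_def
    using ract_comp[OF torus_comp[OF mem'(2)[OF that] mem(3)[OF that]] mem'(1)[OF that]]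
      ract_comp[OF mem(3)[OF that] mem'(2)[OF that]] by simp
  ultimately show "w = sigma1 (ract \<theta> h c)"
    unfolding w using mem
    by (simp add: commutator_dirac_ract ract_sigma1 linear_sum[OF bounded_linear.linear] bounded_linear_sigma)
qed

section \<open>Strong connections and compatibility\<close>

lemma torus_diff:
  assumes "a \<in> torus \<theta>" "b \<in> torus \<theta>"
  shows "(\<lambda>v. a v - b v) \<in> torus \<theta>" "ract \<theta> h (\<lambda>v. a v - b v) = ract \<theta> h a - ract \<theta> h b"
  using torus_add[OF assms(1) torus_scaleR[OF assms(2), of "- 1"]]
    ract_add[OF assms(1) torus_scaleR[OF assms(2), of "- 1"]] ract_scaleR[OF assms(2), of _ "- 1"]
  by simp_all

text \<open>The component \<open>\<alpha>\<close> in front of \<open>sigma1\<close> has degree zero because \<open>\<omega>\<close> and \<open>sigma2\<close> both commute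
  with \<open>delta2\<close>.\<close>

lemma strong_connectionE:
  assumes "strong_connection \<theta> \<omega>"
  obtains \<alpha> where "\<alpha> \<in> base \<theta>" "\<omega> = (\<lambda>v. sigma1 (\<alpha> v) + sigma2 v)"
proof -
  obtain n :: nat and p q where pq: "\<And>i. i < n \<Longrightarrow> p i \<in> torus \<theta>" "\<And>i. i < n \<Longrightarrow> q i \<in> torus \<theta>"
    and \<omega>: "\<omega> = (\<lambda>v. \<Sum>i<n. p i (commutator dirac (q i) v))"
    using assms unfolding strong_connection_def one_forms_def by blast
  have vert: "(\<lambda>v. \<Sum>i<n. p i (commutator delta2 (q i) v)) = (\<lambda>v. v)"
    by (rule assms[unfolded strong_connection_def, THEN conjunct2, THEN conjunct2, THEN conjunct1,
          THEN spec, THEN spec, THEN spec, THEN mp]) (use pq \<omega> in simp)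
  define \<alpha> where "\<alpha> v = (\<Sum>i<n. p i (commutator delta1 (q i) v))" for v
  have \<alpha>: "\<alpha> \<in> torus \<theta>"
    unfolding \<alpha>_def using pq by (intro torus_form_coefficient) auto
  have \<omega>': "\<omega> = (\<lambda>v. sigma1 (\<alpha> v) + sigma2 v)"
  proof
    fix v
    show "\<omega> v = sigma1 (\<alpha> v) + sigma2 v"
      using one_form_sum[of "{..<n}" p \<theta> q v] pq fun_cong[OF vert, of v] by (simp add: \<omega> \<alpha>_def)
  qed
  have "commutator delta2 \<alpha> = (\<lambda>v. 0)"
  proof (rule commutator_eqI[OF single_valued_delta(2) dense_Domain_delta(2) bounded_linear_zero])
    fix v w assume vw: "(v, w) \<in> delta2"
    then have "(\<omega> v, \<omega> w) \<in> delta2"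
      using assms unfolding strong_connection_def by blast
    from subspace_diff[OF subspace_delta(2) this delta2_sigma2[OF vw]]
    show "(\<alpha> v, 0 + \<alpha> w) \<in> delta2"
      by (simp add: \<omega>' delta2_sigma1)
  qed
  with \<alpha> \<omega>' that show thesis by (simp add: base_iff)
qed

lemma nabla_eq:
  assumes "\<alpha> \<in> torus \<theta>" "a \<in> torus \<theta>"
  shows "nabla (\<lambda>v. sigma1 (\<alpha> v) + sigma2 v) a = (\<lambda>v. sigma1 (commutator delta1 a v - commutator delta2 a (\<alpha> v)))"
  using torus_commutator[OF assms(2)] assms
  by (auto simp: nabla_def commutator_dirac torus_linear torus_sigma sigma_linear)

text \<open>On a generating pair with \<open>v = h a\<close> the Leibniz rule gives \<open>delta1 v = h (D\<^sub>1 a) + (delta1 h) a\<close> and, as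
  \<open>delta2 h = 0\<close>, \<open>delta2 v = h (D\<^sub>2 a)\<close>; these combine to the two terms on the right. The right-hand side
  is a linear subspace, so it contains the span.\<close>

lemma twisted_dirac_subset:
  assumes \<alpha>: "\<alpha> \<in> torus \<theta>"
  shows "twisted_dirac \<theta> (\<lambda>v. sigma1 (\<alpha> v) + sigma2 v) \<subseteq>
    {(v, sigma1 (x - ract \<theta> y \<alpha>)) | v x y. (v, x) \<in> delta1 \<and> (v, y) \<in> delta2}" (is "_ \<subseteq> ?G")
  unfolding twisted_dirac_def
proof (rule span_minimal)
  let ?\<omega> = "\<lambda>v. sigma1 (\<alpha> v) + sigma2 v"
  have GI: "(v, w) \<in> ?G" if "(v, x) \<in> delta1" "(v, y) \<in> delta2" "w = sigma1 (x - ract \<theta> y \<alpha>)" for v w x y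
    using that by blast
  show "{(ract \<theta> h a, ract \<theta> w a + ract_form \<theta> h (nabla ?\<omega> a)) | h w a.
    (h, 0) \<in> delta2 \<and> (h, w) \<in> dirac_h \<and> (\<exists>k. a \<in> torus_deg \<theta> k)} \<subseteq> ?G"
  proof
    fix z assume "z \<in> {(ract \<theta> h a, ract \<theta> w a + ract_form \<theta> h (nabla ?\<omega> a)) | h w a.
      (h, 0) \<in> delta2 \<and> (h, w) \<in> dirac_h \<and> (\<exists>k. a \<in> torus_deg \<theta> k)}"
    then obtain h w a k where z: "z = (ract \<theta> h a, ract \<theta> w a + ract_form \<theta> h (nabla ?\<omega> a))"
      and h: "(h, 0) \<in> delta2" "(h, w) \<in> dirac_h" and "a \<in> torus_deg \<theta> k" by blast
    from this(4) have a: "a \<in> torus \<theta>" by (simp add: torus_deg_def)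
    note D = torus_commutator[OF a]
    obtain x where x: "(h, x) \<in> delta1" "w = sigma1 x" using h(2) unfolding dirac_h by blast
    have "ract_form \<theta> h (nabla ?\<omega> a) = sigma1 (ract \<theta> h (commutator delta1 a) - ract \<theta> (ract \<theta> h (commutator delta2 a)) \<alpha>)"
      using D \<alpha> by (simp add: nabla_eq[OF \<alpha> a] ract_form_sigma1 torus_diff torus_comp ract_comp)
    then show "z \<in> ?G"
      unfolding z by (intro GI[OF ract_Leibniz(1)[OF a x(1)] ract_Leibniz(2)[OF a h(1)]])
        (simp add: x(2) ract_linear[OF a] ract_sigma1[OF a] sigma_linear)
  qed
  show "subspace ?G"
  proof (rule subspaceI)
    have zero: "(0, 0) \<in> V" if "subspace V" for V :: graph
      using subspace_0[OF that] by (subst (asm) zero_prod_def)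
    have "(0, 0) \<in> ?G"
      by (rule GI[OF zero zero]) (simp_all add: subspace_delta ract_linear[OF \<alpha>] sigma_linear)
    then show "0 \<in> ?G" by (subst zero_prod_def)
  next
    fix z z' assume "z \<in> ?G" "z' \<in> ?G"
    then obtain v x y v' x' y' where z: "z = (v, sigma1 (x - ract \<theta> y \<alpha>))" "z' = (v', sigma1 (x' - ract \<theta> y' \<alpha>))"
      and m: "(v, x) \<in> delta1" "(v, y) \<in> delta2" "(v', x') \<in> delta1" "(v', y') \<in> delta2" by blast
    have "(v + v', x + x') \<in> delta1" "(v + v', y + y') \<in> delta2"
      using subspace_add[OF subspace_delta(1) m(1,3)] subspace_add[OF subspace_delta(2) m(2,4)] by simp_all
    then show "z + z' \<in> ?G"
      unfolding z add_Pair by (rule GI) (simp add: ract_linear[OF \<alpha>] sigma_linear)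
  next
    fix r z assume "z \<in> ?G"
    then obtain v x y where z: "z = (v, sigma1 (x - ract \<theta> y \<alpha>))"
      and m: "(v, x) \<in> delta1" "(v, y) \<in> delta2" by blast
    have "(r *\<^sub>R v, r *\<^sub>R x) \<in> delta1" "(r *\<^sub>R v, r *\<^sub>R y) \<in> delta2"
      using subspace_scale[OF subspace_delta(1) m(1), of r] subspace_scale[OF subspace_delta(2) m(2), of r] by simp_all
    then show "r *\<^sub>R z \<in> ?G"
      unfolding z scaleR_Pair by (rule GI) (simp add: ract_linear[OF \<alpha>] sigma_linear scaleR_diff_right)
  qed
qed

text \<open>The functional that reads off the coordinate \<open>(m, 1)\<close> of \<open>v \<alpha>\<close> is continuous and vanishes on \<open>S\<close>,
  since \<open>delta2 (v \<alpha>) = (delta2 v) \<alpha> = 0\<close> there. At \<open>v = ket (0, 1)\<close> it is a phase times the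
  coefficient of \<open>U\<^sup>m\<close> in \<open>\<alpha>\<close>.\<close>

lemma base_eq_0:
  assumes \<alpha>: "\<alpha> \<in> base \<theta>"
    and dense: "closure S = UNIV" and S: "\<And>v. v \<in> S \<Longrightarrow> \<exists>y. (v, y) \<in> delta2 \<and> ract \<theta> y \<alpha> = 0"
  shows "\<alpha> = (\<lambda>v. 0)"
proof -
  have \<alpha>': "\<alpha> \<in> torus \<theta>" "commutator delta2 \<alpha> = (\<lambda>v. 0)" using \<alpha> by (auto simp: base_iff)
  obtain a where a: "rapid a" "\<alpha> = spin (lmul \<theta> a)" using \<alpha>'(1) by (rule torusE)
  have row: "coord (fst (ract \<theta> v \<alpha>)) (m, 1) = 0" for v m
  proof -
    have bl: "bounded_linear (\<lambda>v. coord (fst (ract \<theta> v \<alpha>)) (m, 1))"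
      by (intro bounded_linear_compose[OF bounded_linear_coord] bounded_linear_compose[OF bounded_linear_fst]
          ract_bounded_linear[OF \<alpha>'(1)])
    have "closed {v. coord (fst (ract \<theta> v \<alpha>)) (m, 1) = 0}"
      by (intro closed_Collect_eq linear_continuous_on[OF bl] continuous_on_const)
    moreover have "coord (fst (ract \<theta> v \<alpha>)) (m, 1) = 0" if v: "v \<in> S" for v
    proof -
      obtain y where "(v, y) \<in> delta2" "ract \<theta> y \<alpha> = 0" using S[OF v] by blast
      from ract_Leibniz(2)[OF \<alpha>'(1) this(1)] this(2) have "(ract \<theta> v \<alpha>, 0) \<in> delta2"
        by (simp add: \<alpha>'(2) ract_zero)
      then have "coord (fst (0::spinor)) (m, 1) = of_int (snd (m, 1::int)) * coord (fst (ract \<theta> v \<alpha>)) (m, 1)"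
        unfolding delta_grading grading_iff by blast
      then show ?thesis by simp
    qed
    then have "S \<subseteq> {v. coord (fst (ract \<theta> v \<alpha>)) (m, 1) = 0}" by blast
    ultimately have "closure S \<subseteq> {v. coord (fst (ract \<theta> v \<alpha>)) (m, 1) = 0}" by (rule closure_minimal[rotated])
    then show ?thesis using dense by auto
  qed
  have "a (m, n) = 0" for m n
  \<comment> \<open>The coefficients off the row \<open>n = 0\<close> vanish because \<open>\<alpha>\<close> has degree zero.\<close>
  proof (cases "n = 0")
    case True
    have "coord (rmul \<theta> a (ket (0, 1))) (m, 1) = 0"
      using row[of "(ket (0, 1), 0)" m] unfolding a(2) ract_spin[OF a(1)] by (simp add: spin_def)
    then show ?thesis
      by (simp add: right.coord_shift_series_ket[OF a(1)] True)
  next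
    case False
    have "spin (lmul \<theta> (\<lambda>i. of_int (snd i) * a i)) (vac, 0) = 0"
      using \<alpha>'(2) by (simp add: a commutator_delta)
    then have "lmul \<theta> (\<lambda>i. of_int (snd i) * a i) vac = 0" by (simp add: spin_def zero_prod_def)
    from arg_cong[OF this, of coord] have "of_int n * a (m, n) = 0"
      unfolding coord_lmul_vac[OF rapid_snd[OF a(1)]] by (simp add: fun_eq_iff)
    then show ?thesis using False by simp
  qed
  then have "a = (\<lambda>i. 0)" by auto
  then have "lmul \<theta> a = lmul \<theta> (\<lambda>i. 0 * a i)" by simp
  also have "\<dots> = (\<lambda>f. 0)"
    by (rule ext, unfold left.shift_series_scale[OF a(1)], rule ell2_eqI) simp
  finally have "lmul \<theta> a = (\<lambda>f. 0)" .
  then show ?thesis by (auto simp: a spin_def zero_prod_def)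
qed

text \<open>This is the case \<open>\<alpha> = 0\<close>; the normalisation on vertical fields is the uniqueness of components.\<close>

lemma strong_connection_sigma2: "strong_connection \<theta> sigma2"
  unfolding strong_connection_def
proof (intro conjI)
  have s2: "sigma2 = (\<lambda>v. sigma1 ((\<lambda>v. 0) v) + sigma2 v)" by (simp add: sigma_linear)
  show "sigma2 \<in> one_forms (torus \<theta>)" by (rule sigma2_one_form)
  show "\<forall>(v, w)\<in>delta2. (sigma2 v, sigma2 w) \<in> delta2" using delta2_sigma2 by auto
  show "\<forall>(n::nat) p q. (\<forall>i<n. p i \<in> torus \<theta> \<and> q i \<in> torus \<theta>) \<and>
      sigma2 = (\<lambda>v. \<Sum>i<n. p i (commutator dirac (q i) v)) \<longrightarrow>
    (\<lambda>v. \<Sum>i<n. p i (commutator delta2 (q i) v)) = (\<lambda>v. v)"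
  proof (intro allI impI, elim conjE)
    fix n :: nat and p q
    assume pq: "\<forall>i<n. p i \<in> torus \<theta> \<and> q i \<in> torus \<theta>"
      and eq: "sigma2 = (\<lambda>v. \<Sum>i<n. p i (commutator dirac (q i) v))"
    show "(\<lambda>v. \<Sum>i<n. p i (commutator delta2 (q i) v)) = (\<lambda>v. v)"
    proof (rule sigma_forms_eqD(2))
      show "(\<lambda>v. \<Sum>i<n. p i (commutator delta1 (q i) v)) \<in> torus \<theta>"
        using pq by (intro torus_form_coefficient) auto
      show "(\<lambda>v. \<Sum>i<n. p i (commutator delta2 (q i) v)) \<in> torus \<theta>"
        using pq by (intro torus_form_coefficient) auto
      fix v
      show "sigma1 (\<Sum>i<n. p i (commutator delta1 (q i) v)) + sigma2 (\<Sum>i<n. p i (commutator delta2 (q i) v)) =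
          sigma1 0 + sigma2 v"
        using one_form_sum[of "{..<n}" p \<theta> q v] pq fun_cong[OF eq, of v] by (simp add: sigma_linear)
    qed (rule torus_zero torus_id)+
  qed
  show "\<forall>a\<in>torus \<theta>. nabla sigma2 a \<in> base_forms_torus \<theta>"
  proof
    fix a assume a: "a \<in> torus \<theta>"
    have "nabla sigma2 a = (\<lambda>v. sigma1 (commutator delta1 a v))"
      by (subst s2, subst nabla_eq[OF torus_zero a]) (simp add: torus_linear(3)[OF torus_commutator(2)[OF a]])
    then show "nabla sigma2 a \<in> base_forms_torus \<theta>"
      unfolding base_forms_torus_def
      by (intro CollectI exI[of _ "1::nat"] exI[of _ "\<lambda>_. sigma1"] exI[of _ "\<lambda>_. commutator delta1 a"])
        (simp add: sigma1_one_form torus_commutator(1)[OF a])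
  qed
qed

text \<open>The subspace is only real-linear, hence the complex multiples of the basis vectors.\<close>

lemma dense_subspace_ket:
  assumes T: "subspace T" and ket: "\<And>c i. (c *\<^sub>C ket i, 0) \<in> T" "\<And>c i. (0, c *\<^sub>C ket i) \<in> T"
  shows "closure T = (UNIV :: spinor set)"
proof -
  have "(f, g) \<in> closure T" for f g
  proof (rule Lim_in_closed_set)
    let ?p = "\<lambda>F. (\<Sum>i\<in>F. coord f i *\<^sub>C ket i, \<Sum>i\<in>F. coord g i *\<^sub>C ket i)"
    show "(?p \<longlongrightarrow> (f, g)) (finite_subsets_at_top UNIV)"
      using ket_has_sum[of f] ket_has_sum[of g] unfolding has_sum_def by (rule tendsto_Pair)
    have "?p F \<in> T" if "finite F" for F
      using that
    proof induction
      case empty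
      then show ?case using subspace_0[OF T] by (simp add: zero_prod_def)
    next
      case (insert i F)
      have "(coord f i *\<^sub>C ket i, 0) + (0, coord g i *\<^sub>C ket i) + ?p F \<in> T"
        by (intro subspace_add[OF T] ket insert)
      then show ?case using insert by simp
    qed
    then show "\<forall>\<^sub>F F in finite_subsets_at_top UNIV. ?p F \<in> closure T"
      by (intro eventually_finite_subsets_at_top_weakI) (use closure_subset in blast)
  qed simp_all
  then show ?thesis by auto
qed

text \<open>The basis vectors lie in the domain as translates of the vacuum, which is killed by \<open>delta1\<close>
  and \<open>delta2\<close>.\<close>

lemma compatible_sigma2: "compatible \<theta> sigma2"
proof -
  have s2: "sigma2 = (\<lambda>v. sigma1 ((\<lambda>v. 0) v) + sigma2 v)" by (simp add: sigma_linear)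
  have sub: "twisted_dirac \<theta> sigma2 \<subseteq> dirac_h"
  proof
    fix z assume "z \<in> twisted_dirac \<theta> sigma2"
    then obtain v x y where z: "z = (v, sigma1 (x - ract \<theta> y (\<lambda>v. 0)))" "(v, x) \<in> delta1" "(v, y) \<in> delta2"
      using twisted_dirac_subset[OF torus_zero, of \<theta>] unfolding s2[symmetric] by blast
    have "z = (v, sigma1 x)" using z(1) by (simp add: ract_zero)
    then show "z \<in> dirac_h" unfolding dirac_h using z(2,3) by blast
  qed
  have "closure (fst ` twisted_dirac \<theta> sigma2) = UNIV"
  proof (rule dense_subspace_ket)
    show "subspace (fst ` twisted_dirac \<theta> sigma2)"
      unfolding twisted_dirac_def by (intro linear_subspace_image[OF linear_fst] subspace_span)
    have gen: "spin (right_weyl \<theta> k) h \<in> fst ` twisted_dirac \<theta> sigma2" if "(h, 0) \<in> delta1" "(h, 0) \<in> delta2" for h k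
    proof -
      have "(h, 0) \<in> dirac_h"
        unfolding dirac_h by (intro CollectI exI[of _ h] exI[of _ 0]) (use that in \<open>auto simp: sigma_linear\<close>)
      moreover have "spin (left_weyl \<theta> k) \<in> torus_deg \<theta> (snd k)"
        by (simp add: torus_deg_def torus_weyl commutator_weyl)
      ultimately have "\<exists>w. (ract \<theta> h (spin (left_weyl \<theta> k)), w) \<in> twisted_dirac \<theta> sigma2"
        unfolding twisted_dirac_def using that(2) by (blast intro: span_base)
      then show ?thesis unfolding ract_weyl by force
    qed
    have "right_weyl \<theta> i (c *\<^sub>C vac) = c *\<^sub>C ket i" "right_weyl \<theta> i 0 = 0" for c i
      by (simp add: right.W_scaleC right_weyl_vac) (rule linear_0[OF bounded_linear.linear[OF right.bounded_linear_W]])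
    moreover have "((c *\<^sub>C vac, 0), 0) \<in> grading d" "((0, c *\<^sub>C vac), 0) \<in> grading d" if "d (0, 0) = 0" for c and d :: "int \<times> int \<Rightarrow> int"
      using that by (auto simp: grading_iff coord_ket)
    ultimately show "(c *\<^sub>C ket i, 0) \<in> fst ` twisted_dirac \<theta> sigma2" "(0, c *\<^sub>C ket i) \<in> fst ` twisted_dirac \<theta> sigma2" for c i
      using gen[of "(c *\<^sub>C vac, 0)" i] gen[of "(0, c *\<^sub>C vac)" i] by (simp_all add: delta_grading spin_def)
  qed
  then show ?thesis
    unfolding compatible_def using sub by (intro exI[of _ "fst ` twisted_dirac \<theta> sigma2"]) force
qed

theorem corollary6p4:
  fixes \<theta> :: real
  assumes "\<theta> \<notin> \<rat>"
  shows "{\<omega>. strong_connection \<theta> \<omega> \<and> compatible \<theta> \<omega>} = {sigma2}"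
proof (intro equalityI subsetI)
  fix \<omega> assume "\<omega> \<in> {\<omega>. strong_connection \<theta> \<omega> \<and> compatible \<theta> \<omega>}"
  then have \<omega>: "strong_connection \<theta> \<omega>" "compatible \<theta> \<omega>" by auto
  obtain \<alpha> where \<alpha>: "\<alpha> \<in> base \<theta>" and \<omega>_eq: "\<omega> = (\<lambda>v. sigma1 (\<alpha> v) + sigma2 v)"
    using strong_connectionE[OF \<omega>(1)] .
  have \<alpha>': "\<alpha> \<in> torus \<theta>" using \<alpha> by (simp add: base_iff)
  obtain S where "closure S = UNIV" and S: "\<And>v. v \<in> S \<Longrightarrow> \<exists>w. (v, w) \<in> twisted_dirac \<theta> \<omega> \<and> (v, w) \<in> dirac_h"
    using \<omega>(2) unfolding compatible_def by blast
  have "\<alpha> = (\<lambda>v. 0)"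
  proof (rule base_eq_0[OF \<alpha> \<open>closure S = UNIV\<close>])
    fix v assume "v \<in> S"
    then obtain w where w: "(v, w) \<in> twisted_dirac \<theta> \<omega>" "(v, w) \<in> dirac_h" using S by blast
    obtain x y where xy: "(v, x) \<in> delta1" "(v, y) \<in> delta2" "w = sigma1 (x - ract \<theta> y \<alpha>)"
      using w(1) twisted_dirac_subset[OF \<alpha>'] unfolding \<omega>_eq by blast
    obtain x' where x': "(v, x') \<in> delta1" "w = sigma1 x'" using w(2) unfolding dirac_h by blast
    have "x' = x" using single_valuedD[OF single_valued_delta(1) x'(1) xy(1)] .
    moreover have "x' = x - ract \<theta> y \<alpha>" using xy(3) x'(2) sigma_sigma(1) by metis
    ultimately have "ract \<theta> y \<alpha> = 0" by simp
    with xy(2) show "\<exists>y. (v, y) \<in> delta2 \<and> ract \<theta> y \<alpha> = 0" by blast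
  qed
  then show "\<omega> \<in> {sigma2}" by (simp add: \<omega>_eq sigma_linear)
next
  fix \<omega> assume "\<omega> \<in> {sigma2}"
  then show "\<omega> \<in> {\<omega>. strong_connection \<theta> \<omega> \<and> compatible \<theta> \<omega>}"
    using strong_connection_sigma2 compatible_sigma2 by auto
qed

end
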